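(* Let $\alpha\in\mathbb{R}$ with $\alpha\neq 0$. The complex operator ideal $\mathfrak{C}_\alpha:=\{T : T \text{ admits a factorization over the space } Z_\alpha\}$ is not self conjugate, i.e. $\mathfrak{C}_\alpha\neq\overline{\mathfrak{C}_\alpha}$.
   Context: Let $f_\alpha(t):=t^{1+i\alpha}$ for $0\le t<\infty$. For a complex sequence $x=(\xi_k)\in \ell_2$ define $\Omega_\alpha(x)$ by $(\Omega_\alpha(x))_k:=\xi_k f_\alpha\left(\log \frac{\|x\|_2}{|\xi_k|}\right)$ if $\xi_k\neq 0$ and $0$ otherwise. Let $Z_\alpha$ be the space of all pairs $(x,y)$ of complex-valued sequences with $x\in\ell_2$ such that $\|(x,y)\|_\alpha:=\|x\|_2+\|y-\Omega_\alpha(x)\|_2<\infty$; it is known (Kalton) that $\|\cdot\|_\alpha$ is equivalent to a norm under which $Z_\alpha$ is a complex Banach space. A bounded linear operator $T:X\to Y$ between complex Banach spaces admits a factorization over $Z_\alpha$ if $T=BA$ for some bounded linear operators $A:X\to Z_\alpha$ and $B:Z_\alpha\to Y$. For a complex Banach space $X$, its complex conjugate $\overline X$ is the set $X$ with the same norm and addition but scalar multiplication $\lambda\odot x:=\overline{\lambda}x$; for an operator $T:X\to Y$, $\overline T$ denotes the same map regarded as an (again linear) operator $\overline X\to\overline Y$. For a complex operator ideal $\mathfrak{C}$, the conjugate ideal $\overline{\mathfrak{C}}$ consists of all operators $T:X\to Y$ such that $\overline T\in\mathfrak{C}(\overline X,\overline Y)$; $\mathfrak{C}$ is called self conjugate if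 $\mathfrak{C}=\overline{\mathfrak{C}}$. *)

theory Defs
  imports "HOL-Analysis.Analysis"
begin

record 'a cbs =
  cbs_carrier :: "'a set"
  cbs_zero :: 'a
  cbs_add :: "'a \<Rightarrow> 'a \<Rightarrow> 'a"
  cbs_scale :: "complex \<Rightarrow> 'a \<Rightarrow> 'a"
  cbs_norm :: "'a \<Rightarrow> real"

definition cbs_dist :: "'a cbs \<Rightarrow> 'a \<Rightarrow> 'a \<Rightarrow> real" where
  "cbs_dist X x y = cbs_norm X (cbs_add X x (cbs_scale X (-1) y))"

definition complex_banach :: "'a cbs \<Rightarrow> bool" where
  "complex_banach X \<longleftrightarrow>
     (let V = cbs_carrier X; z = cbs_zero X; p = cbs_add X; s = cbs_scale X; n = cbs_norm X in
      z \<in> V \<and>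
      (\<forall>x\<in>V. \<forall>y\<in>V. p x y \<in> V) \<and>
      (\<forall>a. \<forall>x\<in>V. s a x \<in> V) \<and>
      (\<forall>x\<in>V. \<forall>y\<in>V. \<forall>w\<in>V. p (p x y) w = p x (p y w)) \<and>
      (\<forall>x\<in>V. \<forall>y\<in>V. p x y = p y x) \<and>
      (\<forall>x\<in>V. p z x = x) \<and>
      (\<forall>x\<in>V. \<exists>y\<in>V. p x y = z) \<and>
      (\<forall>a b. \<forall>x\<in>V. s (a + b) x = p (s a x) (s b x)) \<and>
      (\<forall>a. \<forall>x\<in>V. \<forall>y\<in>V. s a (p x y) = p (s a x) (s a y)) \<and>
      (\<forall>a b. \<forall>x\<in>V. s (a * b) x = s a (s b x)) \<and>
      (\<forall>x\<in>V. s 1 x = x) \<and>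
      (\<forall>x\<in>V. n x \<ge> 0) \<and>
      (\<forall>x\<in>V. n x = 0 \<longleftrightarrow> x = z) \<and>
      (\<forall>x\<in>V. \<forall>y\<in>V. n (p x y) \<le> n x + n y) \<and>
      (\<forall>a. \<forall>x\<in>V. n (s a x) = cmod a * n x) \<and>
      (\<forall>f :: nat \<Rightarrow> 'a. (\<forall>k. f k \<in> V) \<and>
          (\<forall>e>0. \<exists>N. \<forall>m\<ge>N. \<forall>k\<ge>N. cbs_dist X (f m) (f k) < e)
          \<longrightarrow> (\<exists>x\<in>V. (\<lambda>k. cbs_dist X (f k) x) \<longlonglongrightarrow> 0)))"

definition cbs_conj :: "'a cbs \<Rightarrow> 'a cbs" where
  "cbs_conj X = X\<lparr>cbs_scale := (\<lambda>a x. cbs_scale X (cnj a) x)\<rparr>"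

definition cbs_bounded_linear :: "'a cbs \<Rightarrow> 'b cbs \<Rightarrow> ('a \<Rightarrow> 'b) \<Rightarrow> bool" where
  "cbs_bounded_linear X Y T \<longleftrightarrow>
     (\<forall>x\<in>cbs_carrier X. T x \<in> cbs_carrier Y) \<and>
     (\<forall>x\<in>cbs_carrier X. \<forall>y\<in>cbs_carrier X. T (cbs_add X x y) = cbs_add Y (T x) (T y)) \<and>
     (\<forall>a. \<forall>x\<in>cbs_carrier X. T (cbs_scale X a x) = cbs_scale Y a (T x)) \<and>
     (\<exists>C. \<forall>x\<in>cbs_carrier X. cbs_norm Y (T x) \<le> C * cbs_norm X x)"

definition f_alpha :: "real \<Rightarrow> real \<Rightarrow> complex" where
  "f_alpha \<alpha> t = (complex_of_real t) powr (1 + \<i> * complex_of_real \<alpha>)"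

definition in_l2 :: "(nat \<Rightarrow> complex) \<Rightarrow> bool" where
  "in_l2 x \<longleftrightarrow> summable (\<lambda>k. (cmod (x k))\<^sup>2)"

definition l2norm :: "(nat \<Rightarrow> complex) \<Rightarrow> real" where
  "l2norm x = sqrt (\<Sum>k. (cmod (x k))\<^sup>2)"

definition Omega :: "real \<Rightarrow> (nat \<Rightarrow> complex) \<Rightarrow> (nat \<Rightarrow> complex)" where
  "Omega \<alpha> x = (\<lambda>k. if x k \<noteq> 0 then x k * f_alpha \<alpha> (ln (l2norm x / cmod (x k))) else 0)"

text \<open>Z_alpha with its quasi-norm (equivalent to a norm by Kalton, so boundedness of
  operators into/out of it is the same for the quasi-norm and the equivalent norm).\<close>
definition Z_alpha :: "real \<Rightarrow> ((nat \<Rightarrow> complex) \<times> (nat \<Rightarrow> complex)) cbs" where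
  "Z_alpha \<alpha> =
     \<lparr> cbs_carrier = {(x, y). in_l2 x \<and> in_l2 (\<lambda>k. y k - Omega \<alpha> x k)},
       cbs_zero = (\<lambda>k. 0, \<lambda>k. 0),
       cbs_add = (\<lambda>(x, y) (u, v). (\<lambda>k. x k + u k, \<lambda>k. y k + v k)),
       cbs_scale = (\<lambda>a (x, y). (\<lambda>k. a * x k, \<lambda>k. a * y k)),
       cbs_norm = (\<lambda>(x, y). l2norm x + l2norm (\<lambda>k. y k - Omega \<alpha> x k)) \<rparr>"

definition factors_over_Z :: "real \<Rightarrow> 'a cbs \<Rightarrow> 'b cbs \<Rightarrow> ('a \<Rightarrow> 'b) \<Rightarrow> bool" where
  "factors_over_Z \<alpha> X Y T \<longleftrightarrow>
     (\<exists>A B. cbs_bounded_linear X (Z_alpha \<alpha>) A \<and> cbs_bounded_linear (Z_alpha \<alpha>) Y B \<and>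
            (\<forall>x\<in>cbs_carrier X. T x = B (A x)))"

end

theory Submission
  imports Defs
begin

text \<open>Take \<open>X = Y = Z\<^sub>\<alpha>\<close> and the identity. If its conjugate factored over \<open>Z\<^sub>\<alpha>\<close>, there would be a bounded
  antilinear map \<open>T\<close> on \<open>Z\<^sub>\<alpha>\<close> that is bounded below; but every bounded antilinear \<open>T\<close> satisfies
  \<open>T (0, e\<^sub>j) \<rightarrow> 0\<close>. Indeed, write \<open>T (0, e\<^sub>j) = (a, b)\<close> and \<open>T (e\<^sub>j, 0) = (c, d)\<close>. Testing \<open>T\<close> on flat sums
  of \<open>e\<^sup>2\<^sup>s\<close> basis vectors against flat sums of functionals shows that \<open>a\<close> is negligible and that, coordinatewise
  and up to an error \<open>O(1/s)\<close>, \<open>b\<close> equals \<open>c (f(s + \<sigma>) - f(\<sigma>)) / cnj (f(s))\<close>, where \<open>\<sigma> \<ge> 0\<close> depends on the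
  coordinate only. As a function of \<open>s\<close> this quotient rotates like \<open>s\<^bsup>i\<alpha>\<^esup>\<close> for \<open>s\<close> small compared to \<open>\<sigma>\<close> and like
  \<open>s\<^bsup>2i\<alpha>\<^esup>\<close> for \<open>s\<close> large, so for \<open>\<alpha> \<noteq> 0\<close> comparing four values of \<open>s\<close> forces \<open>c\<close>, and hence \<open>b\<close>, to be small.\<close>

section \<open>The function \<open>f\<^sub>\<alpha>\<close>\<close>

text \<open>The conjugate in the denominator is what makes the argument work. For a linear operator
  the denominator would be \<open>f(s)\<close>, and at \<open>\<sigma> = 0\<close> the quotient
  would be constantly 1, as the identity shows. With \<open>cnj (f(s))\<close> it is
  \<open>cis (2 * \<alpha> * ln s)\<close> there, which moves with \<open>s\<close> exactly when
  \<open>\<alpha>\<close> is nonzero. The numbers \<open>s\<close> are logarithms of norms: a sum of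
  about \<open>exp (2 * s)\<close> distinct unit vectors has l2 norm about \<open>exp s\<close>, and
  on it \<Omega> acts nearly as multiplication by \<open>f(s)\<close>. As \<Omega> is not linear,
  the quasi-norm is awkward to test. It is replaced by gauges, seminorms indexed by finitely
  supported weights, whose supremum is an equivalent norm and behaves well under coordinatewise
  limits. The obstacle is that \<sigma> varies without control from coordinate to coordinate. No
  rotation argument for one range of \<open>s\<close> covers all of them, so the separation of the
  four values must be uniform in \<sigma> and remain valid when all four are scaled up, because the
  error only decays like \<open>1/s\<close>.\<close>

lemma f_alpha_0 [simp]: "f_alpha \<alpha> 0 = 0"
  by (simp add: f_alpha_def)

lemma f_alpha_pos: "t > 0 \<Longrightarrow> f_alpha \<alpha> t = of_real t * cis (\<alpha> * ln t)"
  by (simp add: f_alpha_def powr_def Ln_of_real cis_conv_exp algebra_simps exp_add exp_of_real)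

lemma f_alpha_1 [simp]: "f_alpha \<alpha> 1 = 1"
  by (simp add: f_alpha_pos)

lemma norm_f_alpha [simp]: "t \<ge> 0 \<Longrightarrow> cmod (f_alpha \<alpha> t) = t"
  by (cases "t = 0") (simp_all add: f_alpha_pos norm_mult)

lemma f_alpha_mult: "s \<ge> 0 \<Longrightarrow> t \<ge> 0 \<Longrightarrow> f_alpha \<alpha> (s * t) = f_alpha \<alpha> s * f_alpha \<alpha> t"
  by (cases "s = 0 \<or> t = 0") (auto simp: f_alpha_pos ln_mult cis_mult[symmetric] algebra_simps)

lemma norm_cis_diff_le: "cmod (cis a - cis b) \<le> \<bar>a - b\<bar>"
proof -
  have "cis a - cis b = cis b * (cis (a - b) - 1)"
    by (simp add: algebra_simps cis_mult)
  then have "cmod (cis a - cis b) = cmod (exp (\<i> * of_real (a - b)) - 1)"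
    by (simp add: norm_mult cis_conv_exp)
  also have "\<dots> = 2 * \<bar>sin ((a - b) / 2)\<bar>"
    using dist_exp_i_1[of "a - b"] by (simp add: dist_norm)
  also have "\<dots> \<le> \<bar>a - b\<bar>"
    using abs_sin_x_le_abs_x[of "(a - b) / 2"] by simp
  finally show ?thesis .
qed

text \<open>The derivative of \<open>t powr (1 + \<i> * \<alpha>)\<close> has modulus at most
  \<open>1 + \<bar>\<alpha>\<bar>\<close>. The proof moves modulus and phase separately; the phase
  costs \<open>u * \<bar>\<alpha>\<bar> * (ln t - ln u)\<close>, and the logarithmic increment is at
  most \<open>(t - u) / u\<close>.\<close>

lemma f_alpha_lipschitz:
  assumes "0 \<le> t" "0 \<le> u"
  shows "cmod (f_alpha \<alpha> t - f_alpha \<alpha> u) \<le> (1 + \<bar>\<alpha>\<bar>) * \<bar>t - u\<bar>"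
proof -
  have *: "cmod (f_alpha \<alpha> t - f_alpha \<alpha> u) \<le> (1 + \<bar>\<alpha>\<bar>) * (t - u)"
    if "0 \<le> u" "u \<le> t" for t u
  proof (cases "u = 0")
    case True
    then show ?thesis using that by (simp add: mult_right_mono algebra_simps)
  next
    case False
    with that have pos: "u > 0" "t > 0" by auto
    have "f_alpha \<alpha> t - f_alpha \<alpha> u =
        of_real (t - u) * cis (\<alpha> * ln t) + of_real u * (cis (\<alpha> * ln t) - cis (\<alpha> * ln u))"
      using pos by (simp add: f_alpha_pos algebra_simps)
    then have "cmod (f_alpha \<alpha> t - f_alpha \<alpha> u) \<le>
        (t - u) + u * cmod (cis (\<alpha> * ln t) - cis (\<alpha> * ln u))"
      using that norm_triangle_ineq[of "of_real (t - u) * cis (\<alpha> * ln t)"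
          "of_real u * (cis (\<alpha> * ln t) - cis (\<alpha> * ln u))"]
      by (simp add: norm_mult del: of_real_diff)
    also have "u * cmod (cis (\<alpha> * ln t) - cis (\<alpha> * ln u)) \<le> u * (\<bar>\<alpha>\<bar> * ((t - u) / u))"
    proof (intro mult_left_mono)
      have "\<bar>\<alpha> * ln t - \<alpha> * ln u\<bar> = \<bar>\<alpha>\<bar> * (ln t - ln u)"
        using that pos by (simp add: abs_mult flip: right_diff_distrib)
      also have "\<dots> \<le> \<bar>\<alpha>\<bar> * ((t - u) / u)"
        using ln_diff_le[OF pos(2,1)] by (intro mult_left_mono) auto
      finally show "cmod (cis (\<alpha> * ln t) - cis (\<alpha> * ln u)) \<le> \<bar>\<alpha>\<bar> * ((t - u) / u)"
        using norm_cis_diff_le order_trans by blast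
    qed (use pos in auto)
    also have "u * (\<bar>\<alpha>\<bar> * ((t - u) / u)) = \<bar>\<alpha>\<bar> * (t - u)"
      using pos by simp
    finally show ?thesis by (simp add: distrib_right)
  qed
  show ?thesis
    using *[of u t] *[of t u] assms by (cases "u \<le> t") (auto simp: norm_minus_commute)
qed

lemma f_alpha_expanding:
  assumes "0 \<le> t" "0 \<le> u"
  shows "\<bar>t - u\<bar> \<le> cmod (f_alpha \<alpha> t - f_alpha \<alpha> u)"
  using norm_triangle_ineq3[of "f_alpha \<alpha> t" "f_alpha \<alpha> u"] assms by simp

text \<open>With \<open>\<sigma> = - ln (r k)\<close>, this is the factor by which the first
  coordinate of \<open>T (e, 0)\<close> determines the second coordinate of \<open>T (0, e)\<close>,
  up to errors. The conjugate arises because an antilinear operator maps \<open>(0, f(s) e)\<close>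
  to \<open>cnj (f(s))\<close> times the image of \<open>(0, e)\<close>.\<close>

definition shift_quot :: "real \<Rightarrow> real \<Rightarrow> real \<Rightarrow> complex" where
  "shift_quot \<alpha> \<sigma> s = (f_alpha \<alpha> (s + \<sigma>) - f_alpha \<alpha> \<sigma>) / cnj (f_alpha \<alpha> s)"

lemma cis_diff_cnj: "s > 0 \<Longrightarrow> of_real s / cnj (f_alpha \<alpha> s) = cis (\<alpha> * ln s)"
  by (simp add: f_alpha_pos cis_cnj divide_conv_cnj cis_divide)

text \<open>Regime of small \<open>\<sigma> / s\<close>: taking out \<open>f(s)\<close> leaves the
  phase \<open>f(s) / cnj (f(s))\<close>, which turns at double speed, and a factor close to
  \<open>f(1) - f(0) = 1\<close>.\<close>

lemma shift_quot_near_zero: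
  assumes "s > 0" "\<sigma> \<ge> 0"
  shows "shift_quot \<alpha> \<sigma> s = cis (2 * (\<alpha> * ln s)) * (f_alpha \<alpha> (1 + \<sigma> / s) - f_alpha \<alpha> (\<sigma> / s))"
proof -
  have "f_alpha \<alpha> (s + \<sigma>) = f_alpha \<alpha> s * f_alpha \<alpha> (1 + \<sigma> / s)"
    using assms by (simp add: f_alpha_mult[symmetric] distrib_left)
  moreover have "f_alpha \<alpha> \<sigma> = f_alpha \<alpha> s * f_alpha \<alpha> (\<sigma> / s)"
    using assms by (simp add: f_alpha_mult[symmetric])
  moreover have "f_alpha \<alpha> s / cnj (f_alpha \<alpha> s) = cis (2 * (\<alpha> * ln s))"
    using assms by (simp add: f_alpha_pos cis_cnj cis_divide)
  moreover have "shift_quot \<alpha> \<sigma> s = f_alpha \<alpha> s / cnj (f_alpha \<alpha> s) *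
      (f_alpha \<alpha> (1 + \<sigma> / s) - f_alpha \<alpha> (\<sigma> / s))"
    by (simp add: shift_quot_def right_diff_distrib diff_divide_distrib flip: calculation(1,2))
  ultimately show ?thesis by simp
qed

text \<open>Regime of large \<open>\<sigma> / s\<close>: taking out \<open>f(\<sigma>)\<close>
  instead leaves a phase of single speed in \<open>s\<close> and a difference quotient of
  \<open>f\<close> at 1, close to \<open>1 + \<i> * \<alpha>\<close>.\<close>

lemma shift_quot_near_infinity:
  assumes "s > 0" "\<sigma> > 0"
  shows "shift_quot \<alpha> \<sigma> s =
    cis (\<alpha> * ln \<sigma>) * cis (\<alpha> * ln s) * ((f_alpha \<alpha> (1 + s / \<sigma>) - 1) / of_real (s / \<sigma>))"
proof -
  have "f_alpha \<alpha> (s + \<sigma>) = f_alpha \<alpha> \<sigma> * f_alpha \<alpha> (1 + s / \<sigma>)"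
    using assms by (simp add: f_alpha_mult[symmetric] distrib_left add.commute)
  then have "shift_quot \<alpha> \<sigma> s = f_alpha \<alpha> \<sigma> * (f_alpha \<alpha> (1 + s / \<sigma>) - 1) / cnj (f_alpha \<alpha> s)"
    by (simp add: shift_quot_def algebra_simps)
  also have "\<dots> = cis (\<alpha> * ln \<sigma>) * (of_real s / cnj (f_alpha \<alpha> s)) *
      ((f_alpha \<alpha> (1 + s / \<sigma>) - 1) / of_real (s / \<sigma>))"
    using assms by (simp add: f_alpha_pos field_simps)
  finally show ?thesis using assms by (simp only: cis_diff_cnj)
qed

lemma norm_shift_quot_le:
  assumes "s > 0" "\<sigma> \<ge> 0"
  shows "cmod (shift_quot \<alpha> \<sigma> s) \<le> 1 + \<bar>\<alpha>\<bar>"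
  using f_alpha_lipschitz[of "s + \<sigma>" \<sigma> \<alpha>] assms
  by (simp add: shift_quot_def norm_divide divide_le_eq)

lemma f_alpha_increment_small:
  "\<exists>\<epsilon>>0. \<forall>x. 0 \<le> x \<longrightarrow> x < \<epsilon> \<longrightarrow> cmod (f_alpha \<alpha> (1 + x) - f_alpha \<alpha> x - 1) \<le> 1 / 4"
proof (intro exI conjI allI impI)
  let ?L = "1 + \<bar>\<alpha>\<bar>"
  \<comment> \<open>Each of the two Lipschitz errors is then at most 1/8.\<close>
  show "0 < 1 / (8 * ?L)" by simp
  fix x :: real assume x: "0 \<le> x" "x < 1 / (8 * ?L)"
  then have "?L * x \<le> 1 / 8" by (simp add: field_simps)
  moreover have "cmod (f_alpha \<alpha> (1 + x) - f_alpha \<alpha> 1) \<le> ?L * x" "cmod (f_alpha \<alpha> x - f_alpha \<alpha> 0) \<le> ?L * x"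
    using f_alpha_lipschitz[of "1 + x" 1 \<alpha>] f_alpha_lipschitz[of x 0 \<alpha>] x by simp_all
  ultimately show "cmod (f_alpha \<alpha> (1 + x) - f_alpha \<alpha> x - 1) \<le> 1 / 4"
    using norm_triangle_ineq4[of "f_alpha \<alpha> (1 + x) - 1" "f_alpha \<alpha> x"] 
    by (simp add: algebra_simps)
qed

lemma f_alpha_diff_quot_at_1:
  "((\<lambda>t. (f_alpha \<alpha> (1 + t) - 1) / of_real t) \<longlongrightarrow> 1 + \<i> * of_real \<alpha>) (at_right 0)"
proof -
  have "((\<lambda>z. z powr (1 + \<i> * of_real \<alpha>)) has_field_derivative (1 + \<i> * of_real \<alpha>)) (at 1)"
    by (auto intro!: derivative_eq_intros)
  then have "((\<lambda>h. ((1 + h) powr (1 + \<i> * of_real \<alpha>) - 1) / h) \<longlongrightarrow> 1 + \<i> * of_real \<alpha>) (at (0::complex))"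
    by (simp add: DERIV_def)
  moreover have "filterlim complex_of_real (at 0) (at_right 0)"
    by (auto simp: filterlim_at eventually_at_filter intro!: tendsto_eq_intros)
  ultimately show ?thesis
    unfolding f_alpha_def by (auto dest: filterlim_compose)
qed

text \<open>Passing from \<open>s\<close> to \<open>s * \<rho>\<close> multiplies the quotient by
  nearly \<plusminus>\<open>\<i>\<close> when \<open>\<sigma>\<close> dominates and by nearly -1
  when \<open>s\<close> dominates, so it moves in either regime. The factor \<kappa> is large enough
  that for every \<sigma> at least one of the two pairs lies well inside one regime. Neither factor
  depends on \<open>l\<close>, which is therefore free to be taken large later.\<close>

lemma shift_quot_separated:
  assumes "\<alpha> \<noteq> 0"
  obtains \<rho> \<kappa> :: real where "\<rho> \<ge> 1" "\<kappa> \<ge> 1"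
    "\<And>l \<sigma>. l > 0 \<Longrightarrow> \<sigma> \<ge> 0 \<Longrightarrow>
      1 / 2 \<le> cmod (shift_quot \<alpha> \<sigma> l - shift_quot \<alpha> \<sigma> (l * \<rho>)) +
              cmod (shift_quot \<alpha> \<sigma> (l * \<kappa>) - shift_quot \<alpha> \<sigma> (l * \<kappa> * \<rho>))"
proof -
  \<comment> \<open>Chosen so that \<open>\<alpha> * ln s\<close> grows by a quarter turn with the
    sign of \<alpha>.\<close>
  define \<rho> where "\<rho> = exp (pi / (2 * \<bar>\<alpha>\<bar>))"
  have \<rho>: "\<rho> \<ge> 1" by (simp add: \<rho>_def)
  have ln\<rho>: "\<alpha> * ln (l * \<rho>) = \<alpha> * ln l + sgn \<alpha> * (pi / 2)" if "l > 0" for l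
    using assms that by (simp add: \<rho>_def ln_mult algebra_simps sgn_if)
  have sgn: "sgn \<alpha> = 1 \<or> sgn \<alpha> = -1" using assms by (auto simp: sgn_if)
  obtain \<epsilon> where \<epsilon>: "\<epsilon> > 0"
    "\<And>x. 0 \<le> x \<Longrightarrow> x < \<epsilon> \<Longrightarrow> cmod (f_alpha \<alpha> (1 + x) - f_alpha \<alpha> x - 1) \<le> 1 / 4"
    using f_alpha_increment_small by blast
  have "\<forall>\<^sub>F t in at_right 0. dist ((f_alpha \<alpha> (1 + t) - 1) / of_real t) (1 + \<i> * of_real \<alpha>) < 1 / 4"
    by (rule tendstoD[OF f_alpha_diff_quot_at_1]) simp
  then obtain \<delta> where \<delta>: "\<delta> > 0"
    "\<And>t. 0 < t \<Longrightarrow> t < \<delta> \<Longrightarrow> cmod ((f_alpha \<alpha> (1 + t) - 1) / of_real t - (1 + \<i> * of_real \<alpha>)) < 1 / 4"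
    by (auto simp: eventually_at_right_field dist_norm)
  \<comment> \<open>If \<open>\<sigma> \<le> 2 * l * \<rho> / \<delta>\<close>, then
    \<open>\<sigma> / (l * \<kappa>)\<close> is at most \<open>\<epsilon> / 2\<close>; otherwise
    \<open>l * \<rho> / \<sigma>\<close> is below \<open>\<delta> / 2\<close>. These are the two
    cases below.\<close>
  define \<kappa> where "\<kappa> = max 1 (4 * \<rho> / (\<delta> * \<epsilon>))"
  show ?thesis
  proof (rule that[OF \<rho>, of \<kappa>])
    show "\<kappa> \<ge> 1" by (simp add: \<kappa>_def)
    fix l \<sigma> :: real assume l: "l > 0" and \<sigma>: "\<sigma> \<ge> 0"
    show "1 / 2 \<le> cmod (shift_quot \<alpha> \<sigma> l - shift_quot \<alpha> \<sigma> (l * \<rho>)) +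
              cmod (shift_quot \<alpha> \<sigma> (l * \<kappa>) - shift_quot \<alpha> \<sigma> (l * \<kappa> * \<rho>))"
    proof (cases "\<sigma> \<le> 2 * l * \<rho> / \<delta>")
      case True
      define s where "s = l * \<kappa>"
      have s: "s > 0" using l by (simp add: s_def \<kappa>_def)
      have "\<sigma> < \<epsilon> * s"
      proof -
        have "4 * \<rho> / (\<delta> * \<epsilon>) \<le> \<kappa>" by (simp add: \<kappa>_def)
        then have "4 * \<rho> / \<delta> \<le> \<epsilon> * \<kappa>" using \<epsilon>(1) \<delta>(1) by (simp add: field_simps)
        then have "l * (4 * \<rho> / \<delta>) \<le> l * (\<epsilon> * \<kappa>)" using l by (intro mult_left_mono) auto
        moreover have "2 * l * \<rho> / \<delta> < l * (4 * \<rho> / \<delta>)" using l \<rho> \<delta>(1) by (simp add: field_simps)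
        ultimately show ?thesis using True by (simp add: s_def algebra_simps)
      qed
      moreover have "\<epsilon> * s \<le> \<epsilon> * (s * \<rho>)" using \<epsilon>(1) s \<rho> by simp
      ultimately have x: "\<sigma> / s < \<epsilon>" "\<sigma> / (s * \<rho>) < \<epsilon>" 
        using s \<rho> by (simp_all add: divide_less_eq)
      define h where "h x = f_alpha \<alpha> (1 + x) - f_alpha \<alpha> x" for x
      have h: "cmod (h (\<sigma> / s) - 1) \<le> 1 / 4" "cmod (h (\<sigma> / (s * \<rho>)) - 1) \<le> 1 / 4"
        using \<epsilon>(2) x \<sigma> s \<rho> by (simp_all add: h_def)
      \<comment> \<open>The doubled phase makes a half turn, so the difference becomes a sum of two
        terms within 1/4 of 1.\<close>
      have "cis (2 * (\<alpha> * ln (s * \<rho>))) = - cis (2 * (\<alpha> * ln s))"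
        using sgn by (auto simp: ln\<rho>[OF s] complex_eq_iff distrib_left)
      then have "shift_quot \<alpha> \<sigma> s - shift_quot \<alpha> \<sigma> (s * \<rho>) =
          cis (2 * (\<alpha> * ln s)) * (h (\<sigma> / s) + h (\<sigma> / (s * \<rho>)))"
        using s \<rho> \<sigma> by (simp add: shift_quot_near_zero h_def algebra_simps)
      then have "cmod (shift_quot \<alpha> \<sigma> s - shift_quot \<alpha> \<sigma> (s * \<rho>)) =
          cmod (2 + ((h (\<sigma> / s) - 1) + (h (\<sigma> / (s * \<rho>)) - 1)))"
        by (simp add: norm_mult)
      moreover have "\<dots> \<ge> 2 - cmod ((h (\<sigma> / s) - 1) + (h (\<sigma> / (s * \<rho>)) - 1))"
        using norm_diff_ineq[of 2 "(h (\<sigma> / s) - 1) + (h (\<sigma> / (s * \<rho>)) - 1)"] by simp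
      moreover have "cmod ((h (\<sigma> / s) - 1) + (h (\<sigma> / (s * \<rho>)) - 1)) \<le> 1 / 4 + 1 / 4"
        using h by (intro norm_triangle_mono)
      ultimately have "cmod (shift_quot \<alpha> \<sigma> s - shift_quot \<alpha> \<sigma> (s * \<rho>)) \<ge> 1 / 2"
        by linarith
      then show ?thesis unfolding s_def by (intro add_increasing) auto
    next
      case False
      then have "\<sigma> > 0" using l \<rho> \<delta>(1) by (smt (verit) divide_pos_pos mult_pos_pos)
      have "l \<le> l * \<rho>" using l \<rho> by simp
      moreover have "2 * l * \<rho> < \<sigma> * \<delta>" using False \<delta>(1) by (simp add: field_simps)
      moreover have "0 < l * \<rho>" using l \<rho> by simp
      ultimately have "l < \<delta> * \<sigma>" "l * \<rho> < \<delta> * \<sigma>" by (auto simp: algebra_simps)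
      then have x: "l / \<sigma> < \<delta>" "l * \<rho> / \<sigma> < \<delta>" 
        using \<open>\<sigma> > 0\<close> by (simp_all add: divide_less_eq)
      define h where "h t = (f_alpha \<alpha> (1 + t) - 1) / of_real t" for t
      define D where "D = 1 + \<i> * of_real \<alpha>"
      have h: "cmod (h (l / \<sigma>) - D) \<le> 1 / 4" "cmod (h (l * \<rho> / \<sigma>) - D) \<le> 1 / 4"
        using \<delta>(2)[of "l / \<sigma>"] \<delta>(2)[of "l * \<rho> / \<sigma>"] x l \<rho> \<open>\<sigma> > 0\<close> \<open>0 < l * \<rho>\<close>
        unfolding h_def D_def by (simp_all add: less_imp_le)
      define J where "J = of_real (sgn \<alpha>) * \<i>"
      have J: "cmod J = 1" using sgn by (auto simp: J_def)
      have "cis (\<alpha> * ln (l * \<rho>)) = J * cis (\<alpha> * ln l)"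
        using sgn by (auto simp: ln\<rho>[OF l] complex_eq_iff J_def cos_add sin_add)
      then have "shift_quot \<alpha> \<sigma> l - shift_quot \<alpha> \<sigma> (l * \<rho>) =
          cis (\<alpha> * ln \<sigma>) * cis (\<alpha> * ln l) * (h (l / \<sigma>) - J * h (l * \<rho> / \<sigma>))"
        using l \<rho> \<open>\<sigma> > 0\<close> by (simp add: shift_quot_near_infinity h_def algebra_simps)
      moreover have "h (l / \<sigma>) - J * h (l * \<rho> / \<sigma>) =
          D * (1 - J) + ((h (l / \<sigma>) - D) - J * (h (l * \<rho> / \<sigma>) - D))"
        by (simp add: algebra_simps)
      ultimately have "cmod (shift_quot \<alpha> \<sigma> l - shift_quot \<alpha> \<sigma> (l * \<rho>)) =
          cmod (D * (1 - J) + ((h (l / \<sigma>) - D) - J * (h (l * \<rho> / \<sigma>) - D)))"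
        by (simp add: norm_mult)
      moreover have "\<dots> \<ge> cmod (D * (1 - J)) - cmod ((h (l / \<sigma>) - D) - J * (h (l * \<rho> / \<sigma>) - D))"
        by (rule norm_diff_ineq)
      moreover have "cmod ((h (l / \<sigma>) - D) - J * (h (l * \<rho> / \<sigma>) - D)) \<le> 1 / 4 + 1 / 4"
        using norm_triangle_ineq4[of "h (l / \<sigma>) - D" "J * (h (l * \<rho> / \<sigma>) - D)"] h J
        by (simp add: norm_mult)
      \<comment> \<open>Both factors have real part 1, as \<open>J\<close> is purely imaginary. The
        perturbation of at most 1/2 leaves the 1/2 of the claim.\<close>
      moreover have "cmod (D * (1 - J)) \<ge> 1 * 1"
        unfolding norm_mult
      proof (rule mult_mono)
        show "1 \<le> cmod D" using abs_Re_le_cmod[of D] by (simp add: D_def)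
        show "1 \<le> cmod (1 - J)" using abs_Re_le_cmod[of "1 - J"] by (simp add: J_def)
      qed auto
      ultimately have "cmod (shift_quot \<alpha> \<sigma> l - shift_quot \<alpha> \<sigma> (l * \<rho>)) \<ge> 1 / 2"
        by linarith
      then show ?thesis by (intro add_increasing2) auto
    qed
  qed
qed

section \<open>Duality for \<open>Z\<^sub>\<alpha>\<close>\<close>

definition dual_weight :: "(nat \<Rightarrow> real) \<Rightarrow> nat set \<Rightarrow> bool" where
  "dual_weight r K \<longleftrightarrow> finite K \<and> (\<forall>k\<in>K. 0 \<le> r k) \<and> (\<Sum>k\<in>K. (r k)\<^sup>2) \<le> 1"

text \<open>The maximum, over all \<open>u\<close> with \<open>\<bar>u\<bar> = r\<close>, of the
  modulus of \<open>\<Sum> u * (y - x * f(s - ln r))\<close>; hence a seminorm in \<open>v\<close>.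
  The parameter \<open>s\<close> records what the logarithm gains when the weight is multiplied by
  \<open>exp (- s)\<close>. Where \<open>r k = 0\<close> the prefactor hides the default value
  \<open>ln 0 = 0\<close>.\<close>

definition dual_gauge :: "real \<Rightarrow> real \<Rightarrow> (nat \<Rightarrow> real) \<Rightarrow> nat set \<Rightarrow>
    (nat \<Rightarrow> complex) \<times> (nat \<Rightarrow> complex) \<Rightarrow> real" where
  "dual_gauge \<alpha> s r K v = (\<Sum>k\<in>K. r k * cmod (snd v k - fst v k * f_alpha \<alpha> (s - ln (r k))))"

definition seq_add :: "(nat \<Rightarrow> complex) \<times> (nat \<Rightarrow> complex) \<Rightarrow>
    (nat \<Rightarrow> complex) \<times> (nat \<Rightarrow> complex) \<Rightarrow> (nat \<Rightarrow> complex) \<times> (nat \<Rightarrow> complex)" where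
  "seq_add v w = (\<lambda>k. fst v k + fst w k, \<lambda>k. snd v k + snd w k)"

definition seq_scale :: "complex \<Rightarrow> (nat \<Rightarrow> complex) \<times> (nat \<Rightarrow> complex) \<Rightarrow>
    (nat \<Rightarrow> complex) \<times> (nat \<Rightarrow> complex)" where
  "seq_scale a v = (\<lambda>k. a * fst v k, \<lambda>k. a * snd v k)"

lemma dual_weightD:
  assumes "dual_weight r K"
  shows "finite K" "\<And>k. k \<in> K \<Longrightarrow> 0 \<le> r k" "(\<Sum>k\<in>K. (r k)\<^sup>2) \<le> 1" "\<And>k. k \<in> K \<Longrightarrow> r k \<le> 1"
    "\<And>k. k \<in> K \<Longrightarrow> 0 \<le> - ln (r k)"
proof -
  show *: "finite K" "\<And>k. k \<in> K \<Longrightarrow> 0 \<le> r k" "(\<Sum>k\<in>K. (r k)\<^sup>2) \<le> 1"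
    using assms by (auto simp: dual_weight_def)
  show **: "r k \<le> 1" if "k \<in> K" for k
  proof -
    have "(r k)\<^sup>2 \<le> (\<Sum>k\<in>K. (r k)\<^sup>2)" using * that by (intro member_le_sum) auto
    then have "(r k)\<^sup>2 \<le> 1\<^sup>2" using *(3) by simp
    then show ?thesis by (rule power2_le_imp_le) simp
  qed
  show "0 \<le> - ln (r k)" if "k \<in> K" for k
    using *(2)[OF that] **[OF that] by (cases "r k = 0") auto
qed

lemma dual_weight_subset:
  assumes "dual_weight r K" "J \<subseteq> K"
  shows "dual_weight r J"
proof -
  have "(\<Sum>k\<in>J. (r k)\<^sup>2) \<le> (\<Sum>k\<in>K. (r k)\<^sup>2)"
    using assms by (intro sum_mono2) (auto simp: dual_weight_def)
  then show ?thesis using assms by (auto simp: dual_weight_def finite_subset)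
qed

lemma dual_weight_scale:
  assumes "dual_weight r K" "0 \<le> c" "c \<le> 1"
  shows "dual_weight (\<lambda>k. c * r k) K"
proof -
  have "(\<Sum>k\<in>K. (c * r k)\<^sup>2) = c\<^sup>2 * (\<Sum>k\<in>K. (r k)\<^sup>2)"
    by (simp add: power_mult_distrib sum_distrib_left)
  also have "\<dots> \<le> 1 * 1"
    using assms by (intro mult_mono) (auto simp: dual_weight_def power_le_one sum_nonneg)
  finally show ?thesis using assms by (auto simp: dual_weight_def)
qed

lemma gauge_add:
  assumes "dual_weight r K"
  shows "dual_gauge \<alpha> s r K (seq_add v w) \<le> dual_gauge \<alpha> s r K v + dual_gauge \<alpha> s r K w"
  unfolding dual_gauge_def sum.distrib[symmetric]
proof (rule sum_mono)
  fix k assume "k \<in> K"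
  let ?f = "f_alpha \<alpha> (s - ln (r k))"
  have "snd (seq_add v w) k - fst (seq_add v w) k * ?f = (snd v k - fst v k * ?f) + (snd w k - fst w k * ?f)"
    by (simp add: seq_add_def algebra_simps)
  then show "r k * cmod (snd (seq_add v w) k - fst (seq_add v w) k * ?f) \<le>
      r k * cmod (snd v k - fst v k * ?f) + r k * cmod (snd w k - fst w k * ?f)"
    using dual_weightD(2)[OF assms \<open>k \<in> K\<close>] 
    by (simp add: norm_triangle_ineq mult_left_mono flip: distrib_left)
qed

lemma gauge_scale: "dual_gauge \<alpha> s r K (seq_scale c v) = cmod c * dual_gauge \<alpha> s r K v"
proof -
  have "c * y - c * x * z = c * (y - x * z)" for x y z :: complex
    by (simp add: algebra_simps)
  then show ?thesis
    by (simp add: dual_gauge_def seq_scale_def sum_distrib_left norm_mult mult.left_commute)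
qed

section \<open>The l2 norm through finite weights\<close>

lemma l2norm_nonneg: "in_l2 x \<Longrightarrow> 0 \<le> l2norm x"
  by (simp add: l2norm_def in_l2_def suminf_nonneg)

lemma l2norm_power2: "in_l2 x \<Longrightarrow> (l2norm x)\<^sup>2 = (\<Sum>k. (cmod (x k))\<^sup>2)"
  by (simp add: l2norm_def in_l2_def suminf_nonneg)

lemma sum_le_l2norm:
  assumes "in_l2 x" "finite K"
  shows "(\<Sum>k\<in>K. (cmod (x k))\<^sup>2) \<le> (l2norm x)\<^sup>2"
  using assms by (simp add: l2norm_power2 in_l2_def sum_le_suminf)

lemma norm_le_l2norm: "in_l2 x \<Longrightarrow> cmod (x k) \<le> l2norm x"
  using sum_le_l2norm[of x "{k}"] l2norm_nonneg[of x] by (auto intro: power2_le_imp_le)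

lemma weighted_sum_le_l2norm:
  assumes "in_l2 x" "dual_weight r K"
  shows "(\<Sum>k\<in>K. r k * cmod (x k)) \<le> l2norm x"
proof -
  have "(\<Sum>k\<in>K. r k * cmod (x k)) \<le> L2_set r K * L2_set (\<lambda>k. cmod (x k)) K"
    using L2_set_mult_ineq[of r "\<lambda>k. cmod (x k)" K] assms(2)
    by (simp add: dual_weightD)
  also have "\<dots> \<le> 1 * l2norm x"
  proof (rule mult_mono)
    show "L2_set r K \<le> 1" using dual_weightD(3)[OF assms(2)] by (simp add: L2_set_def)
    show "L2_set (\<lambda>k. cmod (x k)) K \<le> l2norm x"
      using sum_le_l2norm[OF assms(1) dual_weightD(1)[OF assms(2)]] l2norm_nonneg[OF assms(1)]
      by (simp add: L2_set_def real_le_lsqrt sum_nonneg)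
  qed (auto simp: L2_set_nonneg)
  finally show ?thesis by simp
qed

text \<open>The normalised truncation of \<open>\<bar>x\<bar>\<close> is itself a weight and returns
  the norm of the truncation, so finite weights bound all partial sums of squares.\<close>

lemma l2_by_duality:
  assumes "\<And>r K. dual_weight r K \<Longrightarrow> (\<Sum>k\<in>K. r k * cmod (x k)) \<le> M" and "0 \<le> M"
  shows "in_l2 x" "l2norm x \<le> M"
proof -
  have *: "(\<Sum>k<n. (cmod (x k))\<^sup>2) \<le> M\<^sup>2" for n
  proof -
    define N where "N = L2_set (\<lambda>k. cmod (x k)) {..<n}"
    have N2: "N\<^sup>2 = (\<Sum>k<n. (cmod (x k))\<^sup>2)" by (simp add: N_def L2_set_def sum_nonneg)
    show ?thesis
    proof (cases "N = 0")
      case True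
      then show ?thesis using N2 by simp
    next
      case False
      then have "N > 0" using L2_set_nonneg by (metis N_def less_eq_real_def)
      have "dual_weight (\<lambda>k. cmod (x k) / N) {..<n}"
        using \<open>N > 0\<close> by (simp add: dual_weight_def power_divide N2[symmetric] flip: sum_divide_distrib)
      then have "(\<Sum>k<n. cmod (x k) / N * cmod (x k)) \<le> M" by (rule assms)
      also have "(\<Sum>k<n. cmod (x k) / N * cmod (x k)) = N\<^sup>2 / N"
        unfolding N2 by (simp add: sum_divide_distrib power2_eq_square)
      finally have "N \<le> M" using \<open>N > 0\<close> by (simp add: power2_eq_square)
      then show ?thesis using \<open>N > 0\<close> N2 by (metis power_mono less_eq_real_def)
    qed
  qed
  show "in_l2 x" unfolding in_l2_def
    by (rule bounded_imp_summable[where B = "M\<^sup>2"]) (use *[of "Suc _"] in \<open>auto simp: lessThan_Suc_atMost\<close>)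
  then have "(l2norm x)\<^sup>2 \<le> M\<^sup>2"
    unfolding l2norm_power2[OF \<open>in_l2 x\<close>] in_l2_def by (intro suminf_le_const *)
  then show "l2norm x \<le> M" using assms(2) by (rule power2_le_imp_le)
qed

lemma mult_abs_ln_ratio_le:
  fixes a b :: real
  assumes "0 < a" "0 < b"
  shows "a * b * \<bar>ln (a / b)\<bar> \<le> a\<^sup>2 + b\<^sup>2"
proof -
  have *: "a * b * ln (a / b) \<le> a\<^sup>2" if "0 < a" "0 < b" for a b :: real
  proof -
    have "ln (a / b) \<le> a / b" using ln_less_self[of "a / b"] divide_pos_pos[OF that] by linarith
    then have "a * b * ln (a / b) \<le> a * b * (a / b)" using that by (intro mult_left_mono) auto
    then show ?thesis using that by (simp add: power2_eq_square)
  qed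
  have ba: "ln (b / a) = - ln (a / b)" using assms by (simp add: ln_div)
  show ?thesis
  proof (cases "0 \<le> ln (a / b)")
    case True
    then have "a * b * \<bar>ln (a / b)\<bar> = a * b * ln (a / b)" by simp
    then show ?thesis using *[OF assms] zero_le_power2[of b] by linarith
  next
    case False
    then have "a * b * \<bar>ln (a / b)\<bar> = b * a * ln (b / a)" by (simp add: ba)
    then show ?thesis using *[OF assms(2,1)] zero_le_power2[of a] by linarith
  qed
qed

text \<open>The functionals \<open>(x, y) \<mapsto> \<Sum> u (y - x f(-ln |u|))\<close>, with \<open>u\<close> in the unit ball of \<open>\<ell>\<^sub>2\<close>, are the
  Kalton--Peck self-duality of \<open>Z\<close>: since \<open>f\<close> is Lipschitz and \<open>a b |ln(a/b)| \<le> a\<^sup>2 + b\<^sup>2\<close>, replacing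
  \<open>x f(-ln |u|)\<close> by \<open>\<Omega>(x)\<close> costs only a multiple of \<open>\<parallel>x\<parallel>\<close>.\<close>

lemma Omega_swap:
  assumes "in_l2 x" "dual_weight r K"
  shows "(\<Sum>k\<in>K. r k * cmod (Omega \<alpha> x k - x k * f_alpha \<alpha> (- ln (r k)))) \<le> 2 * (1 + \<bar>\<alpha>\<bar>) * l2norm x"
proof (cases "l2norm x = 0")
  case True
  then have "x = (\<lambda>_. 0)" using norm_le_l2norm[OF assms(1)] by (auto simp: fun_eq_iff)
  then show ?thesis using True by (simp add: Omega_def)
next
  case False
  define n where "n = l2norm x"
  define L where "L = 1 + \<bar>\<alpha>\<bar>"
  have n: "n > 0" using False l2norm_nonneg[OF assms(1)] by (simp add: n_def)
  have L: "L > 0" by (simp add: L_def)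
  have "r k * cmod (Omega \<alpha> x k - x k * f_alpha \<alpha> (- ln (r k))) \<le> L * n * ((r k)\<^sup>2 + (cmod (x k) / n)\<^sup>2)"
    if k: "k \<in> K" for k
  proof (cases "x k = 0 \<or> r k = 0")
    case True
    then show ?thesis using n L by (auto simp: Omega_def)
  next
    case False
    then have r: "r k > 0" using dual_weightD(2)[OF assms(2) k] by auto
    define z where "z = cmod (x k) / n"
    have z: "z > 0" "z \<le> 1" using False n norm_le_l2norm[OF assms(1), of k] by (auto simp: z_def n_def)
    have "Omega \<alpha> x k - x k * f_alpha \<alpha> (- ln (r k)) = x k * (f_alpha \<alpha> (- ln z) - f_alpha \<alpha> (- ln (r k)))"
      using False n by (simp add: Omega_def z_def n_def ln_div algebra_simps)
    then have "cmod (Omega \<alpha> x k - x k * f_alpha \<alpha> (- ln (r k))) \<le> cmod (x k) * (L * \<bar>- ln z - - ln (r k)\<bar>)"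
      unfolding L_def using f_alpha_lipschitz[of "- ln z" "- ln (r k)" \<alpha>] z dual_weightD(5)[OF assms(2) k]
      by (simp add: norm_mult mult_left_mono)
    also have "\<dots> = L * n * (z * \<bar>ln (r k / z)\<bar>)"
    proof -
      have "ln (r k / z) = ln (r k) - ln z" using z r by (simp add: ln_div)
      moreover have "cmod (x k) = n * z" using n by (simp add: z_def)
      ultimately show ?thesis by simp
    qed
    finally have "r k * cmod (Omega \<alpha> x k - x k * f_alpha \<alpha> (- ln (r k))) \<le> r k * (L * n * (z * \<bar>ln (r k / z)\<bar>))"
      using r by (intro mult_left_mono) auto
    also have "\<dots> = L * n * (r k * z * \<bar>ln (r k / z)\<bar>)" by simp
    also have "\<dots> \<le> L * n * ((r k)\<^sup>2 + z\<^sup>2)"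
      using mult_abs_ln_ratio_le[OF r z(1)] n L by (intro mult_left_mono) auto
    finally show ?thesis by (simp add: z_def)
  qed
  then have "(\<Sum>k\<in>K. r k * cmod (Omega \<alpha> x k - x k * f_alpha \<alpha> (- ln (r k)))) \<le>
      (\<Sum>k\<in>K. L * n * ((r k)\<^sup>2 + (cmod (x k) / n)\<^sup>2))"
    by (rule sum_mono)
  also have "\<dots> = L * n * ((\<Sum>k\<in>K. (r k)\<^sup>2) + (\<Sum>k\<in>K. (cmod (x k))\<^sup>2) / n\<^sup>2)"
    by (simp add: sum_distrib_left[symmetric] sum.distrib power_divide sum_divide_distrib)
  also have "\<dots> \<le> L * n * (1 + 1)"
    using sum_le_l2norm[OF assms(1) dual_weightD(1)[OF assms(2)]] dual_weightD(3)[OF assms(2)] n L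
    by (intro mult_left_mono add_mono) (auto simp: n_def)
  finally show ?thesis by (simp add: L_def n_def algebra_simps)
qed

section \<open>Two-sided comparison of gauges and quasi-norm\<close>

definition Z_quasinorm :: "real \<Rightarrow> (nat \<Rightarrow> complex) \<times> (nat \<Rightarrow> complex) \<Rightarrow> real" where
  "Z_quasinorm \<alpha> v = l2norm (fst v) + l2norm (\<lambda>k. snd v k - Omega \<alpha> (fst v) k)"

definition Z_carrier :: "real \<Rightarrow> ((nat \<Rightarrow> complex) \<times> (nat \<Rightarrow> complex)) set" where
  "Z_carrier \<alpha> = {v. in_l2 (fst v) \<and> in_l2 (\<lambda>k. snd v k - Omega \<alpha> (fst v) k)}"

lemma Z_alpha_simps [simp]:
  "cbs_carrier (Z_alpha \<alpha>) = Z_carrier \<alpha>"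
  "cbs_zero (Z_alpha \<alpha>) = (\<lambda>_. 0, \<lambda>_. 0)"
  "cbs_add (Z_alpha \<alpha>) = seq_add"
  "cbs_scale (Z_alpha \<alpha>) = seq_scale"
  "cbs_norm (Z_alpha \<alpha>) = Z_quasinorm \<alpha>"
  unfolding Z_alpha_def Z_carrier_def seq_add_def seq_scale_def Z_quasinorm_def by (simp_all add: case_prod_unfold)

lemma Z_quasinorm_nonneg: "v \<in> Z_carrier \<alpha> \<Longrightarrow> 0 \<le> Z_quasinorm \<alpha> v"
  by (simp add: Z_quasinorm_def Z_carrier_def l2norm_nonneg)

lemma gauge_le_quasinorm:
  assumes "v \<in> Z_carrier \<alpha>" "dual_weight r K"
  shows "dual_gauge \<alpha> 0 r K v \<le> 2 * (1 + \<bar>\<alpha>\<bar>) * Z_quasinorm \<alpha> v"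
proof -
  have l2: "in_l2 (fst v)" "in_l2 (\<lambda>k. snd v k - Omega \<alpha> (fst v) k)"
    using assms(1) by (auto simp: Z_carrier_def)
  have "dual_gauge \<alpha> 0 r K v \<le> (\<Sum>k\<in>K. r k * cmod (snd v k - Omega \<alpha> (fst v) k) +
      r k * cmod (Omega \<alpha> (fst v) k - fst v k * f_alpha \<alpha> (- ln (r k))))"
    unfolding dual_gauge_def
  proof (rule sum_mono)
    fix k assume "k \<in> K"
    then show "r k * cmod (snd v k - fst v k * f_alpha \<alpha> (0 - ln (r k))) \<le>
        r k * cmod (snd v k - Omega \<alpha> (fst v) k) +
        r k * cmod (Omega \<alpha> (fst v) k - fst v k * f_alpha \<alpha> (- ln (r k)))"
      using dual_weightD(2)[OF assms(2)] norm_triangle_ineq[of "snd v k - Omega \<alpha> (fst v) k"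
          "Omega \<alpha> (fst v) k - fst v k * f_alpha \<alpha> (- ln (r k))"]
      by (simp add: mult_left_mono flip: distrib_left)
  qed
  also have "\<dots> \<le> l2norm (\<lambda>k. snd v k - Omega \<alpha> (fst v) k) + 2 * (1 + \<bar>\<alpha>\<bar>) * l2norm (fst v)"
    unfolding sum.distrib by (intro add_mono weighted_sum_le_l2norm Omega_swap l2 assms)
  also have "\<dots> \<le> 2 * (1 + \<bar>\<alpha>\<bar>) * Z_quasinorm \<alpha> v"
    unfolding Z_quasinorm_def
    using l2norm_nonneg[OF l2(2)] by (simp add: algebra_simps)
  finally show ?thesis .
qed

text \<open>The gauges at \<open>s\<close> and at 0 differ in coordinate \<open>k\<close> by
  \<open>x * (f(s + \<sigma>) - f(\<sigma>))\<close>, and \<open>f\<close> does not shrink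
  distances. Hence a bound on both gauges that is independent of \<open>s\<close> makes the first
  component of order \<open>1/s\<close>.\<close>

lemma increment_le_gauge:
  assumes "dual_weight r K" "0 \<le> s"
  shows "s * (\<Sum>k\<in>K. r k * cmod (fst v k)) \<le> dual_gauge \<alpha> s r K v + dual_gauge \<alpha> 0 r K v"
  unfolding dual_gauge_def sum.distrib[symmetric] sum_distrib_left
proof (rule sum_mono)
  fix k assume k: "k \<in> K"
  define \<sigma> where "\<sigma> = - ln (r k)"
  have r: "0 \<le> r k" and \<sigma>: "0 \<le> \<sigma>" using dual_weightD(2,5)[OF assms(1) k] by (auto simp: \<sigma>_def)
  have "s * cmod (fst v k) \<le> cmod (fst v k * (f_alpha \<alpha> (s + \<sigma>) - f_alpha \<alpha> \<sigma>))"
    using f_alpha_expanding[of "s + \<sigma>" \<sigma> \<alpha>] \<sigma> assms(2) by (simp add: norm_mult mult.commute[of s] mult_left_mono)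
  also have "\<dots> \<le> cmod (snd v k - fst v k * f_alpha \<alpha> (s + \<sigma>)) + cmod (snd v k - fst v k * f_alpha \<alpha> \<sigma>)"
    using norm_triangle_ineq4[of "snd v k - fst v k * f_alpha \<alpha> \<sigma>" "snd v k - fst v k * f_alpha \<alpha> (s + \<sigma>)"]
    by (simp add: algebra_simps)
  finally have "r k * (s * cmod (fst v k)) \<le> r k * (cmod (snd v k - fst v k * f_alpha \<alpha> (s + \<sigma>)) + 
      cmod (snd v k - fst v k * f_alpha \<alpha> \<sigma>))"
    using r by (rule mult_left_mono)
  then show "s * (r k * cmod (fst v k)) \<le> r k * cmod (snd v k - fst v k * f_alpha \<alpha> (s - ln (r k))) +
      r k * cmod (snd v k - fst v k * f_alpha \<alpha> (0 - ln (r k)))"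
    by (simp add: \<sigma>_def algebra_simps)
qed

lemma gauge_shift:
  assumes "\<And>k. k \<in> K \<Longrightarrow> 0 \<le> r k"
  shows "dual_gauge \<alpha> 0 (\<lambda>k. exp (- s) * r k) K v = exp (- s) * dual_gauge \<alpha> s r K v"
  unfolding dual_gauge_def sum_distrib_left
proof (rule sum.cong)
  fix k assume "k \<in> K"
  then show "exp (- s) * r k * cmod (snd v k - fst v k * f_alpha \<alpha> (0 - ln (exp (- s) * r k))) =
      exp (- s) * (r k * cmod (snd v k - fst v k * f_alpha \<alpha> (s - ln (r k))))"
    using assms[of k] by (cases "r k = 0") (auto simp: ln_mult)
qed auto

text \<open>Since \<open>exp (- 1) * r\<close> is again a weight, the gauge at \<open>s = 1\<close>
  is also bounded, by \<open>3 * M\<close>, and comparing it with the gauge at 0 controls the first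
  component by \<open>4 * M\<close>. Only then can \<open>Omega_swap\<close> be used to return from
  \<open>x * f(- ln r)\<close> to \<Omega>.\<close>

lemma quasinorm_by_gauges:
  assumes M: "\<And>r K. dual_weight r K \<Longrightarrow> dual_gauge \<alpha> 0 r K v \<le> M"
  shows "v \<in> Z_carrier \<alpha>" "Z_quasinorm \<alpha> v \<le> 17 * (1 + \<bar>\<alpha>\<bar>) * M"
proof -
  have M0: "0 \<le> M" using M[of "\<lambda>_. 0" "{}"] by (simp add: dual_weight_def dual_gauge_def)
  have x: "(\<Sum>k\<in>K. r k * cmod (fst v k)) \<le> 4 * M" if "dual_weight r K" for r K
  proof -
    have "dual_gauge \<alpha> 0 (\<lambda>k. exp (- 1) * r k) K v \<le> M"
      by (intro M dual_weight_scale that) auto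
    moreover have "dual_gauge \<alpha> 0 (\<lambda>k. exp (- 1) * r k) K v = exp (- 1) * dual_gauge \<alpha> 1 r K v"
      by (rule gauge_shift) (rule dual_weightD(2)[OF that])
    ultimately have "exp (- 1) * dual_gauge \<alpha> 1 r K v \<le> M" by (simp only:)
    then have "dual_gauge \<alpha> 1 r K v \<le> exp 1 * M"
      by (simp add: exp_minus field_simps)
    also have "\<dots> \<le> 3 * M" using exp_le M0 by (intro mult_right_mono) auto
    finally show ?thesis using increment_le_gauge[OF that, of 1 v \<alpha>] M[OF that] by simp
  qed
  have l2x: "in_l2 (fst v)" and nx: "l2norm (fst v) \<le> 4 * M"
    using l2_by_duality[OF x] M0 by auto
  have y: "(\<Sum>k\<in>K. r k * cmod (snd v k - Omega \<alpha> (fst v) k)) \<le> M + 2 * (1 + \<bar>\<alpha>\<bar>) * (4 * M)"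
    if "dual_weight r K" for r K
  proof -
    have "(\<Sum>k\<in>K. r k * cmod (snd v k - Omega \<alpha> (fst v) k)) \<le> 
      (\<Sum>k\<in>K. r k * cmod (snd v k - fst v k * f_alpha \<alpha> (0 - ln (r k))) +
        r k * cmod (Omega \<alpha> (fst v) k - fst v k * f_alpha \<alpha> (- ln (r k))))"
    proof (rule sum_mono)
      fix k assume "k \<in> K"
      then show "r k * cmod (snd v k - Omega \<alpha> (fst v) k) \<le>
          r k * cmod (snd v k - fst v k * f_alpha \<alpha> (0 - ln (r k))) +
          r k * cmod (Omega \<alpha> (fst v) k - fst v k * f_alpha \<alpha> (- ln (r k)))"
        using dual_weightD(2)[OF that] norm_triangle_ineq4[of "snd v k - fst v k * f_alpha \<alpha> (- ln (r k))"
            "Omega \<alpha> (fst v) k - fst v k * f_alpha \<alpha> (- ln (r k))"]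
        by (simp add: mult_left_mono flip: distrib_left)
    qed
    also have "\<dots> \<le> M + 2 * (1 + \<bar>\<alpha>\<bar>) * l2norm (fst v)"
      unfolding sum.distrib using M[OF that] Omega_swap[OF l2x that, of \<alpha>]
      by (intro add_mono) (auto simp: dual_gauge_def)
    also have "\<dots> \<le> M + 2 * (1 + \<bar>\<alpha>\<bar>) * (4 * M)"
      using nx by (intro add_left_mono mult_left_mono) auto
    finally show ?thesis .
  qed
  have *: "in_l2 (\<lambda>k. snd v k - Omega \<alpha> (fst v) k)"
    "l2norm (\<lambda>k. snd v k - Omega \<alpha> (fst v) k) \<le> M + 2 * (1 + \<bar>\<alpha>\<bar>) * (4 * M)"
    using l2_by_duality[OF y] M0 by auto
  show "v \<in> Z_carrier \<alpha>" using l2x *(1) by (simp add: Z_carrier_def)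
  \<comment> \<open>Together with \<open>4 * M\<close> for the first component the total is
    \<open>13 * M + 8 * \<bar>\<alpha>\<bar> * M\<close>; the factor 17 leaves room.\<close>
  have "0 \<le> \<bar>\<alpha>\<bar> * M" using M0 by simp
  moreover have "M + 2 * (1 + \<bar>\<alpha>\<bar>) * (4 * M) = 9 * M + 8 * (\<bar>\<alpha>\<bar> * M)"
    "17 * (1 + \<bar>\<alpha>\<bar>) * M = 17 * M + 17 * (\<bar>\<alpha>\<bar> * M)"
    by (simp_all add: algebra_simps)
  ultimately show "Z_quasinorm \<alpha> v \<le> 17 * (1 + \<bar>\<alpha>\<bar>) * M"
    using *(2) nx M0 unfolding Z_quasinorm_def by linarith
qed

lemma Z_carrier_iff: "v \<in> Z_carrier \<alpha> \<longleftrightarrow> (\<exists>M. \<forall>r K. dual_weight r K \<longrightarrow> dual_gauge \<alpha> 0 r K v \<le> M)"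
proof
  show "\<exists>M. \<forall>r K. dual_weight r K \<longrightarrow> dual_gauge \<alpha> 0 r K v \<le> M" if "v \<in> Z_carrier \<alpha>"
    using gauge_le_quasinorm[OF that] by blast
  show "v \<in> Z_carrier \<alpha>" if "\<exists>M. \<forall>r K. dual_weight r K \<longrightarrow> dual_gauge \<alpha> 0 r K v \<le> M"
    using that by (auto intro: quasinorm_by_gauges(1))
qed

section \<open>A Banach norm on \<open>Z\<^sub>\<alpha>\<close>\<close>

lemma dual_weight_empty: "dual_weight (\<lambda>_. 0) {}"
  by (simp add: dual_weight_def)

text \<open>A supremum of seminorms, so the triangle inequality comes for free. This is a concrete
  choice of the equivalent norm whose existence is Kalton's theorem; the Banach spaces of the
  counterexample carry it, because the quasi-norm itself does not meet
  \<open>complex_banach\<close>'s demands directly.\<close>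

definition Z_norm :: "real \<Rightarrow> (nat \<Rightarrow> complex) \<times> (nat \<Rightarrow> complex) \<Rightarrow> real" where
  "Z_norm \<alpha> v = Sup {dual_gauge \<alpha> 0 r K v | r K. dual_weight r K}"

definition Z_normed :: "real \<Rightarrow> ((nat \<Rightarrow> complex) \<times> (nat \<Rightarrow> complex)) cbs" where
  "Z_normed \<alpha> = (Z_alpha \<alpha>)\<lparr>cbs_norm := Z_norm \<alpha>\<rparr>"

lemma Z_normed_simps [simp]:
  "cbs_carrier (Z_normed \<alpha>) = Z_carrier \<alpha>"
  "cbs_zero (Z_normed \<alpha>) = (\<lambda>_. 0, \<lambda>_. 0)"
  "cbs_add (Z_normed \<alpha>) = seq_add"
  "cbs_scale (Z_normed \<alpha>) = seq_scale"
  "cbs_norm (Z_normed \<alpha>) = Z_norm \<alpha>"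
  by (simp_all add: Z_normed_def)

lemma Z_norm_le: "(\<And>r K. dual_weight r K \<Longrightarrow> dual_gauge \<alpha> 0 r K v \<le> M) \<Longrightarrow> Z_norm \<alpha> v \<le> M"
  unfolding Z_norm_def using dual_weight_empty by (intro cSup_least) blast+

lemma gauge_le_Z_norm:
  assumes "v \<in> Z_carrier \<alpha>" "dual_weight r K"
  shows "dual_gauge \<alpha> 0 r K v \<le> Z_norm \<alpha> v"
proof -
  obtain M where "\<forall>r K. dual_weight r K \<longrightarrow> dual_gauge \<alpha> 0 r K v \<le> M"
    using assms(1) unfolding Z_carrier_iff by blast
  then show ?thesis
    unfolding Z_norm_def using assms(2) by (intro cSup_upper bdd_aboveI[of _ M]) auto
qed

lemma Z_norm_nonneg: "v \<in> Z_carrier \<alpha> \<Longrightarrow> 0 \<le> Z_norm \<alpha> v"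
  using gauge_le_Z_norm[OF _ dual_weight_empty, of v \<alpha>] by (simp add: dual_gauge_def)

lemma Z_norm_le_quasinorm: "v \<in> Z_carrier \<alpha> \<Longrightarrow> Z_norm \<alpha> v \<le> 2 * (1 + \<bar>\<alpha>\<bar>) * Z_quasinorm \<alpha> v"
  by (intro Z_norm_le gauge_le_quasinorm)

lemma quasinorm_le_Z_norm: "v \<in> Z_carrier \<alpha> \<Longrightarrow> Z_quasinorm \<alpha> v \<le> 17 * (1 + \<bar>\<alpha>\<bar>) * Z_norm \<alpha> v"
  by (rule quasinorm_by_gauges(2)) (rule gauge_le_Z_norm)

lemma Z_carrier_add: 
  assumes "v \<in> Z_carrier \<alpha>" "w \<in> Z_carrier \<alpha>"
  shows "seq_add v w \<in> Z_carrier \<alpha>" "Z_norm \<alpha> (seq_add v w) \<le> Z_norm \<alpha> v + Z_norm \<alpha> w"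
proof -
  have *: "dual_gauge \<alpha> 0 r K (seq_add v w) \<le> Z_norm \<alpha> v + Z_norm \<alpha> w" if "dual_weight r K" for r K
    using gauge_add[OF that, of \<alpha> 0 v w] gauge_le_Z_norm[OF assms(1) that] gauge_le_Z_norm[OF assms(2) that]
    by linarith
  show "seq_add v w \<in> Z_carrier \<alpha>" unfolding Z_carrier_iff using * by blast
  show "Z_norm \<alpha> (seq_add v w) \<le> Z_norm \<alpha> v + Z_norm \<alpha> w" using * by (rule Z_norm_le)
qed

lemma seq_scale_scale: "seq_scale a (seq_scale b v) = seq_scale (a * b) v"
  by (simp add: seq_scale_def mult.assoc)

lemma seq_scale_1 [simp]: "seq_scale 1 v = v"
  by (simp add: seq_scale_def)

lemma Z_carrier_scale:
  assumes "v \<in> Z_carrier \<alpha>"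
  shows "seq_scale c v \<in> Z_carrier \<alpha>" "Z_norm \<alpha> (seq_scale c v) = cmod c * Z_norm \<alpha> v"
proof -
  have *: "dual_gauge \<alpha> 0 r K (seq_scale c v) \<le> cmod c * Z_norm \<alpha> v"
    if "dual_weight r K" "v \<in> Z_carrier \<alpha>" for c r K v
    using gauge_le_Z_norm[OF that(2,1)] by (simp add: gauge_scale mult_left_mono)
  have carr: "seq_scale c v \<in> Z_carrier \<alpha>" if "v \<in> Z_carrier \<alpha>" for c v
    unfolding Z_carrier_iff using *[OF _ that] by blast
  have le: "Z_norm \<alpha> (seq_scale c v) \<le> cmod c * Z_norm \<alpha> v" if "v \<in> Z_carrier \<alpha>" for c v
    using *[OF _ that] by (rule Z_norm_le)
  show "seq_scale c v \<in> Z_carrier \<alpha>" using assms by (rule carr)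
  show "Z_norm \<alpha> (seq_scale c v) = cmod c * Z_norm \<alpha> v"
  proof (cases "c = 0")
    case True
    then show ?thesis using le[OF assms, of 0] Z_norm_nonneg[OF carr[OF assms, of 0]] by simp
  next
    case False
    then have "Z_norm \<alpha> v \<le> cmod (1 / c) * Z_norm \<alpha> (seq_scale c v)"
      using le[OF carr[OF assms, of c], of "1 / c"] by (simp add: seq_scale_scale)
    then have "cmod c * Z_norm \<alpha> v \<le> Z_norm \<alpha> (seq_scale c v)"
      using False by (simp add: norm_divide field_simps)
    then show ?thesis using le[OF assms, of c] by simp
  qed
qed

lemma dual_weight_single: "0 \<le> c \<Longrightarrow> c \<le> 1 \<Longrightarrow> dual_weight (\<lambda>_. c) {k}"
  by (simp add: dual_weight_def power_le_one)

lemma coordinate_gauge: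
  "cmod (snd v k - fst v k * f_alpha \<alpha> \<sigma>) = exp \<sigma> * dual_gauge \<alpha> 0 (\<lambda>_. exp (- \<sigma>)) {k} v"
  by (simp add: dual_gauge_def flip: mult.assoc exp_add)

text \<open>Weights on one point give \<open>y - x * f(\<sigma>)\<close> for any
  \<open>\<sigma> \<ge> 0\<close>. The values 0 and 1 yield \<open>y\<close> and
  \<open>y - x\<close>, since \<open>f(0) = 0\<close> and \<open>f(1) = 1\<close>.\<close>

lemma coordinates_le_Z_norm:
  assumes "v \<in> Z_carrier \<alpha>"
  shows "cmod (snd v k) \<le> 4 * Z_norm \<alpha> v" "cmod (fst v k) \<le> 4 * Z_norm \<alpha> v"
proof -
  have *: "cmod (snd v k - fst v k * f_alpha \<alpha> \<sigma>) \<le> exp \<sigma> * Z_norm \<alpha> v" if "0 \<le> \<sigma>" for \<sigma>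
    unfolding coordinate_gauge using that
    by (intro mult_left_mono gauge_le_Z_norm assms dual_weight_single) auto
  have "exp 1 * Z_norm \<alpha> v \<le> 3 * Z_norm \<alpha> v"
    using exp_le Z_norm_nonneg[OF assms] by (intro mult_right_mono) auto
  then show "cmod (snd v k) \<le> 4 * Z_norm \<alpha> v" "cmod (fst v k) \<le> 4 * Z_norm \<alpha> v"
    using *[of 0] *[of 1] norm_triangle_ineq4[of "snd v k" "snd v k - fst v k"] Z_norm_nonneg[OF assms]
    by auto
qed

lemma Z_norm_eq_0_iff:
  assumes "v \<in> Z_carrier \<alpha>"
  shows "Z_norm \<alpha> v = 0 \<longleftrightarrow> v = (\<lambda>_. 0, \<lambda>_. 0)"
proof
  assume "Z_norm \<alpha> v = 0"
  then show "v = (\<lambda>_. 0, \<lambda>_. 0)"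
    using coordinates_le_Z_norm[OF assms] by (auto simp: prod_eq_iff fun_eq_iff)
next
  assume "v = (\<lambda>_. 0, \<lambda>_. 0)"
  then have "seq_scale 0 v = v" by (simp add: seq_scale_def)
  then show "Z_norm \<alpha> v = 0" using Z_carrier_scale(2)[OF assms, of 0] by simp
qed

text \<open>A gauge involves finitely many coordinates, hence is continuous for coordinatewise
  convergence. The Cauchy estimate thus passes to the coordinatewise limit for each gauge, with a
  bound common to all of them.\<close>

lemma Z_norm_complete:
  assumes f: "\<And>k. f k \<in> Z_carrier \<alpha>"
    and cauchy: "\<And>e. e > 0 \<Longrightarrow> \<exists>N. \<forall>m\<ge>N. \<forall>k\<ge>N. Z_norm \<alpha> (seq_add (f m) (seq_scale (-1) (f k))) < e"
  shows "\<exists>v\<in>Z_carrier \<alpha>. (\<lambda>k. Z_norm \<alpha> (seq_add (f k) (seq_scale (-1) v))) \<longlonglongrightarrow> 0"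
proof -
  have diff: "seq_add (f m) (seq_scale (-1) (f k)) \<in> Z_carrier \<alpha>" for m k
    by (intro Z_carrier_add Z_carrier_scale f)
  have Cauchy_coord: "Cauchy (\<lambda>n. fst (f n) k)" "Cauchy (\<lambda>n. snd (f n) k)" for k
  proof -
    have "\<exists>N. \<forall>m\<ge>N. \<forall>n\<ge>N. dist (fst (f m) k) (fst (f n) k) < e \<and> dist (snd (f m) k) (snd (f n) k) < e"
      if e: "e > 0" for e
    proof -
      obtain N where N: "\<forall>m\<ge>N. \<forall>k\<ge>N. Z_norm \<alpha> (seq_add (f m) (seq_scale (-1) (f k))) < e / 4"
        using cauchy[of "e / 4"] e by auto
      have "dist (fst (f m) k) (fst (f n) k) < e \<and> dist (snd (f m) k) (snd (f n) k) < e"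
        if "m \<ge> N" "n \<ge> N" for m n
      proof -
        have "4 * Z_norm \<alpha> (seq_add (f m) (seq_scale (-1) (f n))) < e" using N that by force
        then show ?thesis using coordinates_le_Z_norm[OF diff, of m n k]
          by (simp add: dist_norm seq_add_def seq_scale_def)
      qed
      then show ?thesis by blast
    qed
    then show "Cauchy (\<lambda>n. fst (f n) k)" "Cauchy (\<lambda>n. snd (f n) k)"
      unfolding Cauchy_def by blast+
  qed
  define v where "v = (\<lambda>k. lim (\<lambda>n. fst (f n) k), \<lambda>k. lim (\<lambda>n. snd (f n) k))"
  have lims: "(\<lambda>n. fst (f n) k) \<longlonglongrightarrow> fst v k" "(\<lambda>n. snd (f n) k) \<longlonglongrightarrow> snd v k" for k
    using Cauchy_coord[of k] by (auto simp: v_def Cauchy_convergent_iff convergent_LIMSEQ_iff)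
  have gauge_lim: "(\<lambda>n. dual_gauge \<alpha> 0 r K (seq_add (f m) (seq_scale (-1) (f n)))) \<longlonglongrightarrow>
      dual_gauge \<alpha> 0 r K (seq_add (f m) (seq_scale (-1) v))" for r K m
    unfolding dual_gauge_def seq_add_def seq_scale_def fst_conv snd_conv by (intro tendsto_intros lims)
  have ev: "\<exists>N. \<forall>m\<ge>N. \<forall>r K. dual_weight r K \<longrightarrow> dual_gauge \<alpha> 0 r K (seq_add (f m) (seq_scale (-1) v)) \<le> e"
    if "e > 0" for e
  proof -
    obtain N where N: "\<forall>m\<ge>N. \<forall>k\<ge>N. Z_norm \<alpha> (seq_add (f m) (seq_scale (-1) (f k))) < e"
      using cauchy \<open>e > 0\<close> by blast
    have "dual_gauge \<alpha> 0 r K (seq_add (f m) (seq_scale (-1) v)) \<le> e" if "m \<ge> N" "dual_weight r K" for m r K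
    proof (rule tendsto_upperbound[OF gauge_lim])
      show "\<forall>\<^sub>F n in sequentially. dual_gauge \<alpha> 0 r K (seq_add (f m) (seq_scale (-1) (f n))) \<le> e"
        unfolding eventually_sequentially
      proof (intro exI allI impI)
        fix n assume "n \<ge> N"
        then show "dual_gauge \<alpha> 0 r K (seq_add (f m) (seq_scale (-1) (f n))) \<le> e"
          using gauge_le_Z_norm[OF diff that(2), of m n] N that(1) by force
      qed
    qed simp
    then show ?thesis by blast
  qed
  have "v \<in> Z_carrier \<alpha>"
  proof -
    obtain N where "\<forall>m\<ge>N. \<forall>r K. dual_weight r K \<longrightarrow>
        dual_gauge \<alpha> 0 r K (seq_add (f m) (seq_scale (-1) v)) \<le> 1"
      using ev[of 1] by auto
    then have "seq_add (f N) (seq_scale (-1) v) \<in> Z_carrier \<alpha>" unfolding Z_carrier_iff by blast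
    \<comment> \<open>The limit is recovered as \<open>f N - (f N - v)\<close>.\<close>
    then have "seq_add (f N) (seq_scale (-1) (seq_add (f N) (seq_scale (-1) v))) \<in> Z_carrier \<alpha>"
      by (rule Z_carrier_add(1)[OF f Z_carrier_scale(1)])
    then show ?thesis by (simp add: seq_add_def seq_scale_def)
  qed
  moreover have "(\<lambda>k. Z_norm \<alpha> (seq_add (f k) (seq_scale (-1) v))) \<longlonglongrightarrow> 0"
  proof (rule LIMSEQ_I)
    fix e :: real assume "e > 0"
    then obtain N where "\<forall>m\<ge>N. \<forall>r K. dual_weight r K \<longrightarrow>
        dual_gauge \<alpha> 0 r K (seq_add (f m) (seq_scale (-1) v)) \<le> e / 2"
      using ev[of "e / 2"] by auto
    then have "\<forall>m\<ge>N. Z_norm \<alpha> (seq_add (f m) (seq_scale (-1) v)) \<le> e / 2"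
      by (blast intro: Z_norm_le)
    moreover have "0 \<le> Z_norm \<alpha> (seq_add (f m) (seq_scale (-1) v))" for m
      by (intro Z_norm_nonneg Z_carrier_add Z_carrier_scale f \<open>v \<in> Z_carrier \<alpha>\<close>)
    ultimately show "\<exists>N. \<forall>m\<ge>N. norm (Z_norm \<alpha> (seq_add (f m) (seq_scale (-1) v)) - 0) < e"
      using \<open>e > 0\<close> by (intro exI[of _ N]) force
  qed
  ultimately show ?thesis by blast
qed

lemma complex_banach_Z_normed: "complex_banach (Z_normed \<alpha>)"
  unfolding complex_banach_def Let_def cbs_dist_def Z_normed_simps
proof (intro conjI ballI allI impI)
  show "(\<lambda>_. 0, \<lambda>_. 0) \<in> Z_carrier \<alpha>"
    unfolding Z_carrier_iff by (rule exI[of _ 0]) (simp add: dual_gauge_def)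
  fix v assume "v \<in> Z_carrier \<alpha>"
  then show "\<exists>w\<in>Z_carrier \<alpha>. seq_add v w = (\<lambda>_. 0, \<lambda>_. 0)"
    by (intro bexI[of _ "seq_scale (-1) v"] Z_carrier_scale) (simp_all add: seq_add_def seq_scale_def)
next
  fix f :: "nat \<Rightarrow> (nat \<Rightarrow> complex) \<times> (nat \<Rightarrow> complex)"
  assume "(\<forall>k. f k \<in> Z_carrier \<alpha>) \<and> (\<forall>e>0. \<exists>N. \<forall>m\<ge>N. \<forall>k\<ge>N.
    Z_norm \<alpha> (seq_add (f m) (seq_scale (-1) (f k))) < e)"
  then show "\<exists>v\<in>Z_carrier \<alpha>. (\<lambda>k. Z_norm \<alpha> (seq_add (f k) (seq_scale (-1) v))) \<longlonglongrightarrow> 0"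
    by (intro Z_norm_complete) auto
qed (auto simp: Z_carrier_add Z_carrier_scale Z_norm_nonneg Z_norm_eq_0_iff seq_scale_scale,
  auto simp: seq_add_def seq_scale_def algebra_simps)

text \<open>The spaces of the final statement live over arbitrary types that admit an injection from
  the sequences, so \<open>Z\<close> is copied there along such an injection.\<close>

definition cbs_transport :: "('p \<Rightarrow> 'a) \<Rightarrow> 'p cbs \<Rightarrow> 'a cbs" where
  "cbs_transport g W =
     \<lparr> cbs_carrier = g ` cbs_carrier W,
       cbs_zero = g (cbs_zero W),
       cbs_add = (\<lambda>x y. g (cbs_add W (inv g x) (inv g y))),
       cbs_scale = (\<lambda>a x. g (cbs_scale W a (inv g x))),
       cbs_norm = (\<lambda>x. cbs_norm W (inv g x)) \<rparr>"

lemma complex_banach_transport: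
  assumes g: "inj g" and W: "complex_banach W"
  shows "complex_banach (cbs_transport g W)"
proof -
  have inv [simp]: "inv g (g x) = x" for x using g by simp
  have eq [simp]: "g x = g y \<longleftrightarrow> x = y" for x y using g by (auto dest: injD)
  note props = W[unfolded complex_banach_def Let_def]
  have complete: "\<exists>x\<in>g ` cbs_carrier W. (\<lambda>k. cbs_dist (cbs_transport g W) (f k) x) \<longlonglongrightarrow> 0"
    if f: "\<forall>k. f k \<in> g ` cbs_carrier W"
      and c: "\<forall>e>0. \<exists>N. \<forall>m\<ge>N. \<forall>k\<ge>N. cbs_dist (cbs_transport g W) (f m) (f k) < e" for f
  proof -
    define h where "h k = inv g (f k)" for k
    have h: "h k \<in> cbs_carrier W" for k using f by (auto simp: h_def) (metis inv image_iff)
    have dist: "cbs_dist (cbs_transport g W) (f k) x = cbs_dist W (h k) (inv g x)" for k x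
      by (simp add: cbs_dist_def cbs_transport_def h_def)
    have "\<exists>x\<in>cbs_carrier W. (\<lambda>k. cbs_dist W (h k) x) \<longlonglongrightarrow> 0"
      using props h c unfolding dist h_def[symmetric] by blast
    then show ?thesis unfolding dist by auto
  qed
  show ?thesis
    unfolding complex_banach_def Let_def
  proof (intro conjI)
    show "\<forall>f. (\<forall>k. f k \<in> cbs_carrier (cbs_transport g W)) \<and> (\<forall>e>0. \<exists>N. \<forall>m\<ge>N. \<forall>k\<ge>N.
        cbs_dist (cbs_transport g W) (f m) (f k) < e) \<longrightarrow>
        (\<exists>x\<in>cbs_carrier (cbs_transport g W). (\<lambda>k. cbs_dist (cbs_transport g W) (f k) x) \<longlonglongrightarrow> 0)"
      using complete by (simp add: cbs_transport_def)
  qed (simp add: cbs_transport_def; insert props, elim conjE, (assumption | blast))+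
qed

section \<open>Flat combinations\<close>

definition seq_comb :: "nat set \<Rightarrow> (nat \<Rightarrow> complex) \<Rightarrow> (nat \<Rightarrow> (nat \<Rightarrow> complex) \<times> (nat \<Rightarrow> complex)) \<Rightarrow>
    (nat \<Rightarrow> complex) \<times> (nat \<Rightarrow> complex)" where
  "seq_comb J c v = (\<lambda>k. \<Sum>j\<in>J. c j * fst (v j) k, \<lambda>k. \<Sum>j\<in>J. c j * snd (v j) k)"

lemma seq_comb_empty [simp]: "seq_comb {} c v = (\<lambda>_. 0, \<lambda>_. 0)"
  by (simp add: seq_comb_def)

lemma seq_comb_insert:
  "finite J \<Longrightarrow> a \<notin> J \<Longrightarrow> seq_comb (insert a J) c v = seq_add (seq_comb J c v) (seq_scale (c a) (v a))"
  by (simp add: seq_comb_def seq_add_def seq_scale_def add.commute)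

lemma seq_comb_cong:
  "(\<And>j. j \<in> J \<Longrightarrow> c j = c' j) \<Longrightarrow> seq_comb J c v = seq_comb J c' v"
  by (simp add: seq_comb_def cong: sum.cong)

text \<open>For a seminorm \<open>p\<close>, both \<open>2 * p(V)\<close> and
  \<open>2 * p(w)\<close> are at most \<open>p(V + w) + p(V - w)\<close>. When a vector is added,
  the old gauges use the first bound and the new gauge the second; one of the two signs does at
  least as well as the average.\<close>

lemma signs_enlarge_gauges:
  assumes "finite J" and "\<And>j. j \<in> J \<Longrightarrow> dual_weight (r j) (K j)"
  shows "\<exists>\<epsilon>. (\<forall>j. \<epsilon> j = 1 \<or> \<epsilon> j = -1) \<and>
    (\<Sum>j\<in>J. dual_gauge \<alpha> s (r j) (K j) (v j)) \<le> (\<Sum>j\<in>J. dual_gauge \<alpha> s (r j) (K j) (seq_comb J \<epsilon> v))"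
  using assms
proof (induction J rule: finite_induct)
  case empty
  show ?case by (intro exI[of _ "\<lambda>_. 1"]) simp
next
  case (insert a J)
  define p where "p j w = dual_gauge \<alpha> s (r j) (K j) w" for j w
  from insert obtain \<epsilon> where \<epsilon>: "\<forall>j. \<epsilon> j = 1 \<or> \<epsilon> j = -1"
    "(\<Sum>j\<in>J. p j (v j)) \<le> (\<Sum>j\<in>J. p j (seq_comb J \<epsilon> v))"
    unfolding p_def by auto
  define V where "V = seq_comb J \<epsilon> v"
  define V1 where "V1 = seq_add V (v a)"
  define V2 where "V2 = seq_add V (seq_scale (-1) (v a))"
  have V1: "V1 = seq_comb (insert a J) (\<epsilon>(a := 1)) v"
    using insert.hyps by (auto simp: seq_comb_insert V1_def V_def intro!: arg_cong2[of _ _ _ _ seq_add] seq_comb_cong)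
  have V2: "V2 = seq_comb (insert a J) (\<epsilon>(a := -1)) v"
    using insert.hyps by (auto simp: seq_comb_insert V2_def V_def intro!: arg_cong2[of _ _ _ _ seq_add] seq_comb_cong)
  have sum: "seq_add V1 V2 = seq_scale 2 V" and diff: "seq_add V1 (seq_scale (-1) V2) = seq_scale 2 (v a)"
    by (simp_all add: V1_def V2_def seq_add_def seq_scale_def)
  have "2 * p j V \<le> p j V1 + p j V2" if "j \<in> J" for j
    using gauge_add[OF insert.prems, of j \<alpha> s V1 V2] that
    unfolding p_def sum gauge_scale by simp
  then have "2 * (\<Sum>j\<in>J. p j V) \<le> (\<Sum>j\<in>J. p j V1) + (\<Sum>j\<in>J. p j V2)"
    unfolding sum_distrib_left sum.distrib[symmetric] by (rule sum_mono)
  moreover have "2 * p a (v a) \<le> p a V1 + p a V2"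
    using gauge_add[OF insert.prems, of a \<alpha> s V1 "seq_scale (-1) V2"]
    unfolding p_def diff gauge_scale by simp
  ultimately have "2 * (\<Sum>j\<in>insert a J. p j (v j)) \<le> (\<Sum>j\<in>insert a J. p j V1) + (\<Sum>j\<in>insert a J. p j V2)"
    using insert.hyps \<epsilon>(2) by (simp add: V_def)
  then consider "(\<Sum>j\<in>insert a J. p j (v j)) \<le> (\<Sum>j\<in>insert a J. p j V1)"
    | "(\<Sum>j\<in>insert a J. p j (v j)) \<le> (\<Sum>j\<in>insert a J. p j V2)"
    by linarith
  then show ?case
  proof cases
    case 1
    show ?thesis
    proof (intro exI conjI)
      show "\<forall>j. (\<epsilon>(a := 1)) j = 1 \<or> (\<epsilon>(a := 1)) j = -1" using \<epsilon>(1) by simp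
    qed (rule 1[unfolded V1 p_def])
  next
    case 2
    show ?thesis
    proof (intro exI conjI)
      show "\<forall>j. (\<epsilon>(a := -1)) j = 1 \<or> (\<epsilon>(a := -1)) j = -1" using \<epsilon>(1) by simp
    qed (rule 2[unfolded V2 p_def])
  qed
qed

lemma weighted_log_le:
  assumes "0 \<le> r" "r \<le> 1" "0 \<le> (s::real)"
  shows "r * (s - ln r) \<le> s + 1"
proof (cases "r = 0")
  case False
  then have "- ln r \<le> 1 / r - 1"
    using ln_le_minus_one[of "1 / r"] assms by (simp add: ln_div)
  then have "r * (- ln r) \<le> r * (1 / r - 1)" using assms by (intro mult_left_mono) auto
  moreover have "r * s \<le> s" using assms by (simp add: mult_left_le_one_le)
  ultimately show ?thesis using False assms by (simp add: algebra_simps)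
qed (use assms in auto)

text \<open>The bound is free of the weight, because \<open>r * (s - ln r)\<close> stays bounded as
  \<open>r\<close> tends to 0. So the first \<open>m\<close> coordinates contribute uniformly little
  along a coordinatewise null sequence.\<close>

lemma head_gauge_le:
  assumes "dual_weight r K" "0 \<le> s"
  shows "dual_gauge \<alpha> s r (K \<inter> {..<m}) v \<le> (\<Sum>k<m. cmod (snd v k) + (s + 1) * cmod (fst v k))"
proof -
  have "r k * cmod (snd v k - fst v k * f_alpha \<alpha> (s - ln (r k))) \<le> cmod (snd v k) + (s + 1) * cmod (fst v k)"
    if k: "k \<in> K" for k
  proof -
    have r: "0 \<le> r k" "r k \<le> 1" "0 \<le> - ln (r k)"
      using dual_weightD(2,4,5)[OF assms(1) k] by auto
    have "cmod (snd v k - fst v k * f_alpha \<alpha> (s - ln (r k))) \<le>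
        cmod (snd v k) + cmod (fst v k) * (s - ln (r k))"
      using norm_triangle_ineq4[of "snd v k" "fst v k * f_alpha \<alpha> (s - ln (r k))"] r assms(2)
      by (simp add: norm_mult)
    then have "r k * cmod (snd v k - fst v k * f_alpha \<alpha> (s - ln (r k))) \<le>
        r k * (cmod (snd v k) + cmod (fst v k) * (s - ln (r k)))"
      using r by (intro mult_left_mono) auto
    also have "\<dots> = r k * cmod (snd v k) + r k * (s - ln (r k)) * cmod (fst v k)"
      by (simp add: algebra_simps)
    also have "\<dots> \<le> 1 * cmod (snd v k) + (s + 1) * cmod (fst v k)"
      using r weighted_log_le[OF r(1,2) assms(2)] by (intro add_mono mult_right_mono) auto
    finally show ?thesis by simp
  qed
  then have "dual_gauge \<alpha> s r (K \<inter> {..<m}) v \<le>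
      (\<Sum>k\<in>K \<inter> {..<m}. cmod (snd v k) + (s + 1) * cmod (fst v k))"
    unfolding dual_gauge_def by (intro sum_mono) auto
  also have "\<dots> \<le> (\<Sum>k<m. cmod (snd v k) + (s + 1) * cmod (fst v k))"
    using assms(2) by (intro sum_mono2) auto
  finally show ?thesis .
qed

lemma real_nat_floor_bounds:
  fixes x :: real
  assumes "1 \<le> x"
  shows "real (nat \<lfloor>x\<rfloor>) \<le> x" "x < real (nat \<lfloor>x\<rfloor>) + 1" "1 \<le> real (nat \<lfloor>x\<rfloor>)"
proof -
  have "1 \<le> \<lfloor>x\<rfloor>" using assms by (simp add: le_floor_iff)
  moreover from this have "real (nat \<lfloor>x\<rfloor>) = of_int \<lfloor>x\<rfloor>" by simp
  ultimately show "real (nat \<lfloor>x\<rfloor>) \<le> x" "x < real (nat \<lfloor>x\<rfloor>) + 1" "1 \<le> real (nat \<lfloor>x\<rfloor>)"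
    by linarith+
qed

text \<open>Combining disjointly supported weights \<open>r\<^sub>j\<close> into \<open>e\<^sup>-\<^sup>s \<Sum> r\<^sub>j\<close> turns the logarithm \<open>-ln r\<^sub>j\<close> into
  \<open>s - ln r\<^sub>j\<close>; cross terms between different \<open>v\<^sub>j\<close> are removed by the choice of signs, so no
  sliding hump for the \<open>v\<^sub>j\<close> themselves is needed.\<close>

lemma flat_combination_bound:
  fixes v :: "nat \<Rightarrow> (nat \<Rightarrow> complex) \<times> (nat \<Rightarrow> complex)"
  assumes coords: "\<And>k. (\<lambda>j. fst (v j) k) \<longlonglongrightarrow> 0" "\<And>k. (\<lambda>j. snd (v j) k) \<longlonglongrightarrow> 0"
    and s: "0 \<le> s" and M: "0 \<le> M"
    and bound: "\<And>J \<epsilon> r K. finite J \<Longrightarrow> card J = nat \<lfloor>exp (2 * s)\<rfloor> \<Longrightarrow> (\<forall>j. \<epsilon> j = 1 \<or> \<epsilon> j = -1) \<Longrightarrow>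
      dual_weight r K \<Longrightarrow> dual_gauge \<alpha> 0 r K (seq_comb J \<epsilon> v) \<le> M * exp s"
  shows "\<forall>\<^sub>F j in sequentially. \<forall>r K. dual_weight r K \<longrightarrow> dual_gauge \<alpha> s r K (v j) \<le> 2 * M + 1"
proof (rule ccontr)
  assume "\<not> ?thesis"
  then have freq: "\<exists>\<^sub>F j in sequentially. \<exists>r K. dual_weight r K \<and> dual_gauge \<alpha> s r K (v j) > 2 * M + 1"
    by (simp add: frequently_def not_less)
  define large where "large j r K \<longleftrightarrow> dual_weight r K \<and> dual_gauge \<alpha> s r K (v j) > 2 * M" for j r K
  \<comment> \<open>Dropping the coordinates below \<open>m\<close> costs less than 1 for late
    \<open>j\<close>, which is the extra 1 in the conclusion. The remaining supports can then be
    chosen disjoint one after another.\<close>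
  have far: "\<exists>j\<ge>l. \<exists>r K. large j r K \<and> K \<subseteq> {m..}" for l m
  proof -
    have "(\<lambda>j. \<Sum>k<m. cmod (snd (v j) k) + (s + 1) * cmod (fst (v j) k)) \<longlonglongrightarrow> (\<Sum>k<m. 0 + (s + 1) * 0)"
      by (intro tendsto_intros tendsto_norm_zero coords)
    then have "\<forall>\<^sub>F j in sequentially. (\<Sum>k<m. cmod (snd (v j) k) + (s + 1) * cmod (fst (v j) k)) < 1"
      by (rule order_tendstoD) simp
    then have "\<forall>\<^sub>F j in sequentially. j \<ge> l \<and> (\<Sum>k<m. cmod (snd (v j) k) + (s + 1) * cmod (fst (v j) k)) < 1"
      by (intro eventually_conj eventually_ge_at_top)
    from frequently_eventually_frequently[OF freq this] obtain j r K where
      j: "j \<ge> l" "(\<Sum>k<m. cmod (snd (v j) k) + (s + 1) * cmod (fst (v j) k)) < 1"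
      and rK: "dual_weight r K" "dual_gauge \<alpha> s r K (v j) > 2 * M + 1"
      by (auto dest!: frequently_ex)
    have "dual_gauge \<alpha> s r K (v j) = dual_gauge \<alpha> s r (K \<inter> {..<m}) (v j) + dual_gauge \<alpha> s r (K - {..<m}) (v j)"
      unfolding dual_gauge_def using dual_weightD(1)[OF rK(1)] by (rule sum.Int_Diff)
    then have "dual_gauge \<alpha> s r (K - {..<m}) (v j) > 2 * M"
      using head_gauge_le[OF rK(1) s, of \<alpha> m "v j"] j(2) rK(2) by linarith
    then have "large j r (K - {..<m})"
      using dual_weight_subset[OF rK(1)] by (auto simp: large_def)
    then show ?thesis using j(1) by (intro exI[of _ j] conjI exI[of _ r] exI[of _ "K - {..<m}"]) auto
  qed
  have "\<exists>J r K m. finite J \<and> card J = n \<and> (\<forall>j\<in>J. large j (r j) (K j) \<and> K j \<subseteq> {..<m}) \<and>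
      disjoint_family_on K J" for n
  proof (induction n)
    case 0
    show ?case by (intro exI[of _ "{}"]) (simp add: disjoint_family_on_def)
  next
    case (Suc n)
    then obtain J r K m where IH: "finite J" "card J = n" "\<forall>j\<in>J. large j (r j) (K j) \<and> K j \<subseteq> {..<m}"
      "disjoint_family_on K J" by blast
    obtain a r' K' where a: "a \<ge> Suc (Max (insert 0 J))" "large a r' K'" "K' \<subseteq> {m..}"
      using far by blast
    have "a \<notin> J" using a(1) IH(1) by (meson Max_ge finite_insert insertCI not_less_eq_eq)
    have "finite K'" using a(2) by (auto simp: large_def dual_weight_def)
    then obtain m' where m': "K' \<subseteq> {..<m'}" using finite_nat_bounded by blast
    have disj: "K' \<inter> K j = {}" if "j \<in> J" for j
      using a(3) IH(3) that by fastforce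
    show ?case
    proof (intro exI conjI)
      show "finite (insert a J)" "card (insert a J) = Suc n" using IH \<open>a \<notin> J\<close> by auto
      show "\<forall>j\<in>insert a J. large j ((r(a := r')) j) ((K(a := K')) j) \<and> (K(a := K')) j \<subseteq> {..<max m m'}"
      proof
        fix j assume "j \<in> insert a J"
        then show "large j ((r(a := r')) j) ((K(a := K')) j) \<and> (K(a := K')) j \<subseteq> {..<max m m'}"
          using IH(3)[rule_format, of j] a(2) m' by (cases "j = a") (auto intro: less_max_iff_disj[THEN iffD2])
      qed
      show "disjoint_family_on (K(a := K')) (insert a J)"
        unfolding disjoint_family_on_def
      proof (intro ballI impI)
        fix i j assume ij: "i \<in> insert a J" "j \<in> insert a J" "i \<noteq> j"
        show "(K(a := K')) i \<inter> (K(a := K')) j = {}"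
        proof (cases "i = a \<or> j = a")
          case True
          then show ?thesis using ij disj[of i] disj[of j] by (auto simp: Int_commute)
        next
          case False
          then show ?thesis using ij IH(4) by (simp add: disjoint_family_on_def)
        qed
      qed
    qed
  qed
  from this[of "nat \<lfloor>exp (2 * s)\<rfloor>"] obtain J r K where J: "finite J" "card J = nat \<lfloor>exp (2 * s)\<rfloor>"
    and large: "\<And>j. j \<in> J \<Longrightarrow> large j (r j) (K j)" and disj: "disjoint_family_on K J"
    by blast
  have dw: "dual_weight (r j) (K j)" if "j \<in> J" for j using large[OF that] by (simp add: large_def)
  obtain \<epsilon> where \<epsilon>: "\<forall>j. \<epsilon> j = 1 \<or> \<epsilon> j = -1"
    "(\<Sum>j\<in>J. dual_gauge \<alpha> s (r j) (K j) (v j)) \<le> (\<Sum>j\<in>J. dual_gauge \<alpha> s (r j) (K j) (seq_comb J \<epsilon> v))"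
    using signs_enlarge_gauges[OF J(1), of r K \<alpha> s v] dw by blast
  define U where "U = (\<Union>j\<in>J. K j)"
  define R where "R k = r (THE j. j \<in> J \<and> k \<in> K j) k" for k
  have R: "R k = r j k" if "j \<in> J" "k \<in> K j" for j k
  proof -
    have "(THE i. i \<in> J \<and> k \<in> K i) = j"
      using that disj by (intro the_equality) (auto simp: disjoint_family_on_def)
    then show ?thesis by (simp add: R_def)
  qed
  have fin: "finite U" "\<And>j. j \<in> J \<Longrightarrow> finite (K j)"
    using J(1) dw by (auto simp: U_def dual_weight_def)
  have Rnn: "0 \<le> R k" if "k \<in> U" for k
    using that by (auto simp: U_def R intro: dual_weightD(2)[OF dw])
  have sumU: "(\<Sum>k\<in>U. h (R k) k) = (\<Sum>j\<in>J. \<Sum>k\<in>K j. h (r j k) k)" for h :: "real \<Rightarrow> nat \<Rightarrow> real"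
  proof -
    have "(\<Sum>k\<in>U. h (R k) k) = (\<Sum>j\<in>J. \<Sum>k\<in>K j. h (R k) k)"
      unfolding U_def using J(1) fin(2) disj
      by (intro sum.UNION_disjoint) (auto simp: disjoint_family_on_def)
    also have "\<dots> = (\<Sum>j\<in>J. \<Sum>k\<in>K j. h (r j k) k)"
      by (intro sum.cong) (auto simp: R)
    finally show ?thesis .
  qed
  define N where "N = real (card J)"
  have N: "N \<le> exp (2 * s)" "exp (2 * s) < N + 1" "1 \<le> N"
    unfolding N_def J(2) using s real_nat_floor_bounds[of "exp (2 * s)"] by auto
  \<comment> \<open>The squares of the glued weights sum to at most the number of blocks, which is
    at most \<open>exp (2 * s)\<close>.\<close>
  have "dual_weight (\<lambda>k. exp (- s) * R k) U"
    unfolding dual_weight_def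
  proof (intro conjI ballI)
    have "(\<Sum>k\<in>U. (R k)\<^sup>2) = (\<Sum>j\<in>J. \<Sum>k\<in>K j. (r j k)\<^sup>2)" by (rule sumU)
    also have "\<dots> \<le> (\<Sum>j\<in>J. 1)" using dw by (intro sum_mono) (rule dual_weightD(3))
    also have "\<dots> \<le> exp (2 * s)" using N(1) by (simp add: N_def)
    finally have "(exp (- s))\<^sup>2 * (\<Sum>k\<in>U. (R k)\<^sup>2) \<le> (exp (- s))\<^sup>2 * exp (2 * s)"
      by (intro mult_left_mono) auto
    also have "\<dots> = 1" by (simp add: power2_eq_square flip: exp_add)
    finally show "(\<Sum>k\<in>U. (exp (- s) * R k)\<^sup>2) \<le> 1"
      by (simp add: power_mult_distrib sum_distrib_left)
  qed (use fin Rnn in auto)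
  then have "dual_gauge \<alpha> 0 (\<lambda>k. exp (- s) * R k) U (seq_comb J \<epsilon> v) \<le> M * exp s"
    using bound J \<epsilon>(1) by blast
  moreover have "dual_gauge \<alpha> 0 (\<lambda>k. exp (- s) * R k) U (seq_comb J \<epsilon> v) =
      exp (- s) * dual_gauge \<alpha> s R U (seq_comb J \<epsilon> v)"
    by (rule gauge_shift) (rule Rnn)
  ultimately have "exp (- s) * dual_gauge \<alpha> s R U (seq_comb J \<epsilon> v) \<le> M * exp s" by (simp only:)
  then have "exp s * (exp (- s) * dual_gauge \<alpha> s R U (seq_comb J \<epsilon> v)) \<le> exp s * (M * exp s)"
    by (intro mult_left_mono) auto
  then have "dual_gauge \<alpha> s R U (seq_comb J \<epsilon> v) \<le> M * exp (2 * s)"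
    by (simp add: mult.left_commute flip: mult.assoc exp_add)
  moreover have "dual_gauge \<alpha> s R U (seq_comb J \<epsilon> v) = (\<Sum>j\<in>J. dual_gauge \<alpha> s (r j) (K j) (seq_comb J \<epsilon> v))"
    unfolding dual_gauge_def by (rule sumU)
  moreover have "(\<Sum>j\<in>J. 2 * M) < (\<Sum>j\<in>J. dual_gauge \<alpha> s (r j) (K j) (v j))"
    using J(1) N(3) large by (intro sum_strict_mono) (auto simp: N_def large_def)
  ultimately have "N * (2 * M) < M * exp (2 * s)"
    using \<epsilon>(2) by (simp add: N_def)
  \<comment> \<open>Rounding down costs a factor 2, as
    \<open>exp (2 * s) < N + 1 \<le> 2 * N\<close>; this is the 2 in the conclusion.\<close>
  also have "\<dots> \<le> M * (2 * N)" using M N by (intro mult_left_mono) auto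
  finally show False by simp
qed

section \<open>Flat vectors and their quasi-norms\<close>

definition flat :: "nat set \<Rightarrow> (nat \<Rightarrow> complex) \<Rightarrow> complex \<Rightarrow> complex \<Rightarrow>
    (nat \<Rightarrow> complex) \<times> (nat \<Rightarrow> complex)" where
  "flat J \<theta> a b = (\<lambda>k. if k \<in> J then a * \<theta> k else 0, \<lambda>k. if k \<in> J then b * \<theta> k else 0)"

abbreviation basis_vec :: "complex \<Rightarrow> complex \<Rightarrow> nat \<Rightarrow> (nat \<Rightarrow> complex) \<times> (nat \<Rightarrow> complex)" where
  "basis_vec a b j \<equiv> flat {j} (\<lambda>_. 1) a b"

lemma flat_l2:
  assumes "finite J" "\<And>j. j \<in> J \<Longrightarrow> cmod (\<theta> j) = 1"
  shows "in_l2 (\<lambda>k. if k \<in> J then c * \<theta> k else 0)"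
    "l2norm (\<lambda>k. if k \<in> J then c * \<theta> k else 0) = cmod c * sqrt (real (card J))"
proof -
  let ?x = "\<lambda>k. (cmod (if k \<in> J then c * \<theta> k else 0))\<^sup>2"
  have "?x sums (\<Sum>k\<in>J. ?x k)" using assms(1) by (intro sums_finite) auto
  also have "(\<Sum>k\<in>J. ?x k) = (\<Sum>k\<in>J. (cmod c)\<^sup>2)"
    using assms(2) by (intro sum.cong) (auto simp: norm_mult)
  finally have *: "?x sums (real (card J) * (cmod c)\<^sup>2)" by simp
  show "in_l2 (\<lambda>k. if k \<in> J then c * \<theta> k else 0)"
    using * unfolding in_l2_def by (rule sums_summable)
  show "l2norm (\<lambda>k. if k \<in> J then c * \<theta> k else 0) = cmod c * sqrt (real (card J))"
    by (simp add: l2norm_def sums_unique[OF *, symmetric] real_sqrt_mult)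
qed

lemma flat_0_quasinorm:
  assumes "finite J" "\<And>j. j \<in> J \<Longrightarrow> cmod (\<theta> j) = 1"
  shows "flat J \<theta> 0 b \<in> Z_carrier \<alpha>" "Z_quasinorm \<alpha> (flat J \<theta> 0 b) = cmod b * sqrt (real (card J))"
proof -
  have l2: "in_l2 (\<lambda>k. if k \<in> J then b * \<theta> k else 0)" "in_l2 (\<lambda>_. 0)"
    "l2norm (\<lambda>k. if k \<in> J then b * \<theta> k else 0) = cmod b * sqrt (real (card J))" "l2norm (\<lambda>_. 0) = 0"
    using flat_l2[of J \<theta> b] flat_l2[of J \<theta> 0] assms by (auto cong: if_cong)
  have eq: "(\<lambda>k. snd (flat J \<theta> 0 b) k - Omega \<alpha> (\<lambda>_. 0) k) = (\<lambda>k. if k \<in> J then b * \<theta> k else 0)"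
    "fst (flat J \<theta> 0 b) = (\<lambda>_. 0)"
    by (auto simp: flat_def Omega_def)
  show "flat J \<theta> 0 b \<in> Z_carrier \<alpha>" "Z_quasinorm \<alpha> (flat J \<theta> 0 b) = cmod b * sqrt (real (card J))"
    by (simp_all add: Z_carrier_def Z_quasinorm_def eq l2)
qed

text \<open>All nonzero entries of the first component have modulus 1, so \<Omega> multiplies it by
  the single number \<open>f(ln (sqrt (card J)))\<close>.\<close>

lemma flat_1_quasinorm:
  assumes "finite J" "\<And>j. j \<in> J \<Longrightarrow> cmod (\<theta> j) = 1"
  shows "flat J \<theta> 1 b \<in> Z_carrier \<alpha>"
    "Z_quasinorm \<alpha> (flat J \<theta> 1 b) =
      sqrt (real (card J)) * (1 + cmod (b - f_alpha \<alpha> (ln (sqrt (real (card J))))))"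
proof -
  define t where "t = f_alpha \<alpha> (ln (sqrt (real (card J))))"
  define x where "x = (\<lambda>k. if k \<in> J then \<theta> k else 0)"
  have l2: "in_l2 x" "in_l2 (\<lambda>k. if k \<in> J then (b - t) * \<theta> k else 0)"
    "l2norm (\<lambda>k. if k \<in> J then (b - t) * \<theta> k else 0) = cmod (b - t) * sqrt (real (card J))"
    "l2norm x = sqrt (real (card J))"
    using flat_l2[of J \<theta> "b - t"] flat_l2[of J \<theta> 1] assms by (auto simp: x_def cong: if_cong)
  have "Omega \<alpha> x k = (if k \<in> J then t * \<theta> k else 0)" for k
    using assms(2)[of k] by (auto simp: Omega_def t_def l2(4)) (auto simp: x_def)
  then have eq: "(\<lambda>k. snd (flat J \<theta> 1 b) k - Omega \<alpha> x k) = (\<lambda>k. if k \<in> J then (b - t) * \<theta> k else 0)"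
    "fst (flat J \<theta> 1 b) = x"
    by (auto simp: flat_def left_diff_distrib x_def)
  show "flat J \<theta> 1 b \<in> Z_carrier \<alpha>"
    by (simp add: Z_carrier_def eq l2)
  show "Z_quasinorm \<alpha> (flat J \<theta> 1 b) =
      sqrt (real (card J)) * (1 + cmod (b - f_alpha \<alpha> (ln (sqrt (real (card J))))))"
    by (simp add: Z_quasinorm_def eq l2 algebra_simps flip: t_def)
qed

lemma cnj_sgn_mult: "cnj (sgn z) * z = of_real (cmod z)"
proof (cases "z = 0")
  case False
  have "cnj z * z = (of_real (cmod z))\<^sup>2"
    using complex_norm_square[of z] by (simp add: mult.commute)
  then show ?thesis using False by (simp add: sgn_eq power2_eq_square)
qed simp

text \<open>If infinitely many terms had norm at least \<open>e\<close>, then \<open>n ^ 4\<close>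
  of them would have a sum of at least \<open>n ^ 4 * e\<close>, while the bound is of order
  \<open>n ^ 3\<close>. The fourth power makes the square root of the cardinality a square, and the
  logarithm is absorbed by \<open>2 * n\<close>.\<close>

lemma tendsto_0_if_sums_small:
  fixes \<rho> :: "nat \<Rightarrow> 'a::real_normed_vector"
  assumes "\<And>J. finite J \<Longrightarrow> J \<noteq> {} \<Longrightarrow>
    (\<Sum>j\<in>J. norm (\<rho> j)) \<le> C * (sqrt (real (card J)) * (1 + ln (sqrt (real (card J)))))"
  shows "\<rho> \<longlonglongrightarrow> 0"
proof (rule LIMSEQ_I, rule ccontr)
  fix e :: real assume e: "e > 0" and "\<not> (\<exists>N. \<forall>n\<ge>N. norm (\<rho> n - 0) < e)"
  then have "\<forall>N. \<exists>n\<ge>N. n \<in> {n. e \<le> norm (\<rho> n)}" by (simp add: not_less)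
  then have inf: "infinite {n. e \<le> norm (\<rho> n)}" by (simp add: infinite_nat_iff_unbounded_le)
  have "norm (\<rho> 0) \<le> C" using assms[of "{0}"] by simp
  then have "0 \<le> C" using norm_ge_zero[of "\<rho> 0"] by linarith
  obtain n :: nat where n: "2 * C / e < real n" "0 < n"
    using reals_Archimedean2[of "max (2 * C / e) 0"] by auto
  obtain J where J: "finite J" "card J = n ^ 4" "J \<subseteq> {n. e \<le> norm (\<rho> n)}"
    using infinite_arbitrarily_large[OF inf] by blast
  have "J \<noteq> {}" using J(2) n(2) by auto
  have sq: "sqrt (real (card J)) = (real n)\<^sup>2"
    unfolding J(2) by (simp add: real_sqrt_unique power_mult[symmetric])
  have "(real n) ^ 4 * e = (\<Sum>j\<in>J. e)" by (simp add: J(2))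
  also have "\<dots> \<le> (\<Sum>j\<in>J. norm (\<rho> j))" using J(3) by (intro sum_mono) auto
  also have "\<dots> \<le> C * ((real n)\<^sup>2 * (1 + ln ((real n)\<^sup>2)))"
    using assms[OF J(1) \<open>J \<noteq> {}\<close>] by (simp add: sq)
  also have "\<dots> \<le> C * ((real n)\<^sup>2 * (2 * real n))"
  proof (intro mult_left_mono \<open>0 \<le> C\<close>)
    have "ln ((real n)\<^sup>2) = 2 * ln (real n)" using n(2) by (simp add: ln_realpow)
    also have "\<dots> \<le> 2 * (real n - 1)" using n(2) by (intro mult_left_mono ln_le_minus_one) auto
    finally show "1 + ln ((real n)\<^sup>2) \<le> 2 * real n" by simp
  qed auto
  finally have "(real n)\<^sup>2 * real n * (real n * e) \<le> (real n)\<^sup>2 * real n * (2 * C)"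
    by (simp add: power4_eq_xxxx power2_eq_square algebra_simps)
  then have "real n * e \<le> 2 * C" using n(2) by simp
  then show False using n(1) e by (simp add: field_simps)
qed

section \<open>Antilinear operators on \<open>Z\<^sub>\<alpha>\<close>\<close>

text \<open>Boundedness is expressed by gauges, the form in which it gets used; through
  \<open>quasinorm_by_gauges\<close> it also places the values of \<open>T\<close> in
  \<open>Z\<close>.\<close>

locale bounded_antilinear_on_Z =
  fixes \<alpha> :: real and D :: real
    and T :: "(nat \<Rightarrow> complex) \<times> (nat \<Rightarrow> complex) \<Rightarrow> (nat \<Rightarrow> complex) \<times> (nat \<Rightarrow> complex)"
  assumes add: "\<And>v w. v \<in> Z_carrier \<alpha> \<Longrightarrow> w \<in> Z_carrier \<alpha> \<Longrightarrow> T (seq_add v w) = seq_add (T v) (T w)"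
    and scale: "\<And>c v. v \<in> Z_carrier \<alpha> \<Longrightarrow> T (seq_scale c v) = seq_scale (cnj c) (T v)"
    and bounded: "\<And>r K v. dual_weight r K \<Longrightarrow> v \<in> Z_carrier \<alpha> \<Longrightarrow>
      dual_gauge \<alpha> 0 r K (T v) \<le> D * Z_quasinorm \<alpha> v"
begin

lemma basis_vec_carrier [simp]: "basis_vec 0 b j \<in> Z_carrier \<alpha>" "basis_vec 1 b j \<in> Z_carrier \<alpha>"
  by (auto intro!: flat_0_quasinorm flat_1_quasinorm)

lemma D_nonneg: "0 \<le> D"
  using bounded[OF dual_weight_empty, of "basis_vec 0 1 0"] flat_0_quasinorm(2)[of "{0}" "\<lambda>_. 1" \<alpha> 1]
  by (simp add: dual_gauge_def)

lemma image_flat: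
  assumes J: "finite J" and \<theta>: "\<And>j. j \<in> J \<Longrightarrow> cmod (\<theta> j) = 1" and a: "a = 0 \<or> a = 1"
  shows "T (flat J \<theta> a b) = seq_comb J (\<lambda>j. cnj (\<theta> j)) (\<lambda>j. T (basis_vec a b j))"
  using J \<theta>
proof (induction J rule: finite_induct)
  case empty
  have z: "flat {} \<theta> a b = seq_scale 0 (basis_vec a b 0)" by (simp add: flat_def seq_scale_def)
  have "T (flat {} \<theta> a b) = seq_scale (cnj 0) (T (basis_vec a b 0))"
    unfolding z using a by (intro scale) auto
  then show ?case by (simp add: seq_scale_def)
next
  case (insert j J)
  have c: "flat J \<theta> a b \<in> Z_carrier \<alpha>" "basis_vec a b j \<in> Z_carrier \<alpha>"
    using a insert by (auto intro!: flat_0_quasinorm flat_1_quasinorm)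
  have "flat (insert j J) \<theta> a b = seq_add (flat J \<theta> a b) (seq_scale (\<theta> j) (basis_vec a b j))"
    using insert.hyps by (auto simp: flat_def seq_add_def seq_scale_def fun_eq_iff)
  then show ?case
    using c insert by (simp add: add scale Z_carrier_scale seq_comb_insert)
qed

text \<open>With aligned phases a coordinate functional sums the moduli of its values on the
  \<open>T (basis_vec a b j)\<close>, whereas the quasi-norm of the flat vector grows only like a
  square root times a logarithm.\<close>

lemma image_basis_coords_tendsto_0:
  assumes a: "a = 0 \<and> b = 1 \<or> a = 1 \<and> b = 0"
  shows "(\<lambda>j. fst (T (basis_vec a b j)) k) \<longlonglongrightarrow> 0" "(\<lambda>j. snd (T (basis_vec a b j)) k) \<longlonglongrightarrow> 0"
proof -
  have *: "(\<lambda>j. snd (T (basis_vec a b j)) k - fst (T (basis_vec a b j)) k * f_alpha \<alpha> \<sigma>) \<longlonglongrightarrow> 0"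
    if \<sigma>: "0 \<le> \<sigma>" for \<sigma>
  proof (rule tendsto_0_if_sums_small)
    fix J :: "nat set" assume J: "finite J" "J \<noteq> {}"
    define \<kappa> where "\<kappa> v = snd v k - fst v k * f_alpha \<alpha> \<sigma>" for v :: "(nat \<Rightarrow> complex) \<times> (nat \<Rightarrow> complex)"
    \<comment> \<open>After conjugation by \<open>T\<close> these phases make all terms nonnegative;
      the value 1 at zeros keeps the vector flat.\<close>
    define \<theta> where "\<theta> j = (if \<kappa> (T (basis_vec a b j)) = 0 then 1 else sgn (\<kappa> (T (basis_vec a b j))))" for j
    have \<theta>: "cmod (\<theta> j) = 1" "cnj (\<theta> j) * \<kappa> (T (basis_vec a b j)) = of_real (cmod (\<kappa> (T (basis_vec a b j))))" for j
      by (auto simp: \<theta>_def norm_sgn cnj_sgn_mult)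
    have N: "1 \<le> sqrt (real (card J))" using J by (simp add: Suc_leI card_gt_0_iff)
    have "(\<Sum>j\<in>J. cmod (\<kappa> (T (basis_vec a b j)))) = cmod (\<Sum>j\<in>J. cnj (\<theta> j) * \<kappa> (T (basis_vec a b j)))"
      unfolding \<theta>(2) of_real_sum[symmetric] by (simp add: sum_nonneg del: of_real_sum)
    also have "(\<Sum>j\<in>J. cnj (\<theta> j) * \<kappa> (T (basis_vec a b j))) =
        \<kappa> (seq_comb J (\<lambda>j. cnj (\<theta> j)) (\<lambda>j. T (basis_vec a b j)))"
      by (simp add: \<kappa>_def seq_comb_def right_diff_distrib sum_subtractf sum_distrib_right mult.assoc)
    also have "\<dots> = \<kappa> (T (flat J \<theta> a b))"
      using a by (subst image_flat[OF J(1) \<theta>(1)]) auto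
    also have "cmod (\<kappa> (T (flat J \<theta> a b))) = exp \<sigma> * dual_gauge \<alpha> 0 (\<lambda>_. exp (- \<sigma>)) {k} (T (flat J \<theta> a b))"
      unfolding \<kappa>_def by (rule coordinate_gauge)
    also have "\<dots> \<le> exp \<sigma> * (D * Z_quasinorm \<alpha> (flat J \<theta> a b))"
      using a \<sigma> flat_0_quasinorm(1)[OF J(1) \<theta>(1)] flat_1_quasinorm(1)[OF J(1) \<theta>(1)]
      by (intro mult_left_mono bounded dual_weight_single) auto
    also have "\<dots> \<le> exp \<sigma> * (D * (sqrt (real (card J)) * (1 + ln (sqrt (real (card J))))))"
    proof (intro mult_left_mono D_nonneg)
      show "Z_quasinorm \<alpha> (flat J \<theta> a b) \<le> sqrt (real (card J)) * (1 + ln (sqrt (real (card J))))"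
        using a
      proof
        assume "a = 0 \<and> b = 1"
        then have "Z_quasinorm \<alpha> (flat J \<theta> a b) = sqrt (real (card J)) * 1"
          by (simp add: flat_0_quasinorm[OF J(1) \<theta>(1)])
        also have "\<dots> \<le> sqrt (real (card J)) * (1 + ln (sqrt (real (card J))))"
          using N by (intro mult_left_mono) auto
        finally show ?thesis .
      next
        assume "a = 1 \<and> b = 0"
        then show ?thesis
          using N by (simp add: flat_1_quasinorm[OF J(1) \<theta>(1)])
      qed
    qed auto
    finally show "(\<Sum>j\<in>J. cmod (snd (T (basis_vec a b j)) k - fst (T (basis_vec a b j)) k * f_alpha \<alpha> \<sigma>)) \<le>
        (exp \<sigma> * D) * (sqrt (real (card J)) * (1 + ln (sqrt (real (card J)))))"
      by (simp add: \<kappa>_def mult.assoc)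
  qed
  show snd: "(\<lambda>j. snd (T (basis_vec a b j)) k) \<longlonglongrightarrow> 0"
    using *[of 0] by simp
  show "(\<lambda>j. fst (T (basis_vec a b j)) k) \<longlonglongrightarrow> 0"
    using tendsto_diff[OF snd *[of 1]] by simp
qed

text \<open>Flat vectors in the second component have quasi-norm exactly the square root of their
  length, without logarithm. So their images have gauges bounded independently of \<open>s\<close>:
  \<open>2 * D + 1\<close> at \<open>s\<close> and \<open>D\<close> at 0, and
  \<open>increment_le_gauge\<close> applies with \<open>s\<close> large.\<close>

lemma image_second_basis_fst_small:
  assumes "\<eta> > 0"
  shows "\<forall>\<^sub>F j in sequentially. \<forall>r K. dual_weight r K \<longrightarrow>
    (\<Sum>k\<in>K. r k * cmod (fst (T (basis_vec 0 1 j)) k)) \<le> \<eta>"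
proof -
  define s where "s = (3 * D + 1) / \<eta>"
  have s: "0 \<le> s" using assms D_nonneg by (simp add: s_def)
  have "\<forall>\<^sub>F j in sequentially. \<forall>r K. dual_weight r K \<longrightarrow> dual_gauge \<alpha> s r K (T (basis_vec 0 1 j)) \<le> 2 * D + 1"
  proof (rule flat_combination_bound[OF _ _ s D_nonneg])
    fix J :: "nat set" and \<epsilon> :: "nat \<Rightarrow> complex" and r :: "nat \<Rightarrow> real" and K
    assume J: "finite J" "card J = nat \<lfloor>exp (2 * s)\<rfloor>" and \<epsilon>: "\<forall>j. \<epsilon> j = 1 \<or> \<epsilon> j = (-1 :: complex)"
      and r: "dual_weight r K"
    have \<epsilon>1: "cmod (\<epsilon> j) = 1" "cnj (\<epsilon> j) = \<epsilon> j" for j using \<epsilon>[rule_format, of j] by auto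
    have "seq_comb J \<epsilon> (\<lambda>j. T (basis_vec 0 1 j)) = T (flat J \<epsilon> 0 1)"
      by (subst image_flat[OF J(1)]) (auto simp: \<epsilon>1)
    then have "dual_gauge \<alpha> 0 r K (seq_comb J \<epsilon> (\<lambda>j. T (basis_vec 0 1 j))) \<le> D * sqrt (real (card J))"
      using bounded[OF r, of "flat J \<epsilon> 0 1"] flat_0_quasinorm[OF J(1), of \<epsilon>] \<epsilon>1(1) by simp
    also have "\<dots> \<le> D * exp s"
    proof (intro mult_left_mono D_nonneg real_le_lsqrt)
      have "real (card J) \<le> exp (2 * s)" unfolding J(2) by simp
      then show "real (card J) \<le> (exp s)\<^sup>2" by (simp add: power2_eq_square flip: exp_add)
    qed auto
    finally show "dual_gauge \<alpha> 0 r K (seq_comb J \<epsilon> (\<lambda>j. T (basis_vec 0 1 j))) \<le> D * exp s" .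
  qed (auto intro: image_basis_coords_tendsto_0)
  then show ?thesis
  proof (rule eventually_mono, intro allI impI)
    fix j r K assume j: "\<forall>r K. dual_weight r K \<longrightarrow> dual_gauge \<alpha> s r K (T (basis_vec 0 1 j)) \<le> 2 * D + 1"
      and r: "dual_weight r K"
    have "dual_gauge \<alpha> 0 r K (T (basis_vec 0 1 j)) \<le> D"
      using bounded[OF r, of "basis_vec 0 1 j"] flat_0_quasinorm(2)[of "{j}" "\<lambda>_. 1" \<alpha> 1] by simp
    then have "s * (\<Sum>k\<in>K. r k * cmod (fst (T (basis_vec 0 1 j)) k)) \<le> 3 * D + 1"
      using increment_le_gauge[OF r s, of "T (basis_vec 0 1 j)" \<alpha>] j r by force
    also have "3 * D + 1 = s * \<eta>" using assms by (simp add: s_def)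
    finally show "(\<Sum>k\<in>K. r k * cmod (fst (T (basis_vec 0 1 j)) k)) \<le> \<eta>"
      by (rule mult_left_le_imp_le) (use assms D_nonneg in \<open>simp add: s_def\<close>)
  qed
qed

lemma image_mixed_basis:
  "T (basis_vec 1 b j) = seq_add (T (basis_vec 1 0 j)) (seq_scale (cnj b) (T (basis_vec 0 1 j)))"
proof -
  have "basis_vec 1 b j = seq_add (basis_vec 1 0 j) (seq_scale b (basis_vec 0 1 j))"
    by (auto simp: flat_def seq_add_def seq_scale_def)
  then show ?thesis by (simp add: add scale Z_carrier_scale)
qed

text \<open>The coefficient \<open>f(s)\<close> is matched to the number of summands: for about
  \<open>exp (2 * s)\<close> of them, \<Omega> of their sum is multiplication by
  \<open>f(ln n)\<close> with \<open>ln n\<close> within 1 of \<open>s\<close>, so the quasi-norm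
  exceeds \<open>exp s\<close> by at most a constant factor.\<close>

lemma image_mixed_basis_bound:
  assumes s: "1 \<le> s"
  shows "\<forall>\<^sub>F j in sequentially. \<forall>r K. dual_weight r K \<longrightarrow>
    dual_gauge \<alpha> s r K (T (basis_vec 1 (f_alpha \<alpha> s) j)) \<le> 2 * (D * (2 + \<bar>\<alpha>\<bar>)) + 1"
proof (rule flat_combination_bound)
  let ?v = "\<lambda>j. T (basis_vec 1 (f_alpha \<alpha> s) j)"
  show "0 \<le> s" using s by simp
  show "0 \<le> D * (2 + \<bar>\<alpha>\<bar>)" using D_nonneg by simp
  show "(\<lambda>j. fst (?v j) k) \<longlonglongrightarrow> 0" "(\<lambda>j. snd (?v j) k) \<longlonglongrightarrow> 0" for k
    unfolding image_mixed_basis[where b = "f_alpha \<alpha> s"] seq_add_def seq_scale_def fst_conv snd_conv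
    by (intro tendsto_add_zero tendsto_mult_right_zero image_basis_coords_tendsto_0; simp)+
  fix J :: "nat set" and \<epsilon> :: "nat \<Rightarrow> complex" and r :: "nat \<Rightarrow> real" and K
  assume J: "finite J" "card J = nat \<lfloor>exp (2 * s)\<rfloor>" and \<epsilon>: "\<forall>j. \<epsilon> j = 1 \<or> \<epsilon> j = (-1 :: complex)"
    and r: "dual_weight r K"
  define n where "n = sqrt (real (card J))"
  have N: "real (card J) \<le> exp (2 * s)" "exp (2 * s) < real (card J) + 1" "1 \<le> real (card J)"
    unfolding J(2) using s real_nat_floor_bounds[of "exp (2 * s)"] by auto
  have n: "1 \<le> n" "n \<le> exp s"
  proof -
    show "1 \<le> n" using N(3) by (simp add: n_def)
    show "n \<le> exp s" unfolding n_def
      using N(1) by (intro real_le_lsqrt) (auto simp: power2_eq_square simp flip: exp_add)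
  qed
  have ln: "ln n \<le> s" "s \<le> ln n + 1"
  proof -
    show "ln n \<le> s" using n by (metis exp_gt_zero ln_exp ln_le_cancel_iff less_le_trans zero_less_one)
    \<comment> \<open>Rounding the cardinality down loses a factor 2, which \<open>exp 2\<close>
      absorbs; this is the 1 in \<open>ln n + 1\<close>.\<close>
    have "exp (2 * s) \<le> 2 * n\<^sup>2" using N by (simp add: n_def)
    also have "\<dots> \<le> exp 2 * n\<^sup>2"
      using exp_ge_add_one_self[of 2] by (intro mult_right_mono) auto
    also have "\<dots> = (exp 1 * n)\<^sup>2"
      by (simp add: power_mult_distrib power2_eq_square flip: exp_add)
    finally have "(exp s)\<^sup>2 \<le> (exp 1 * n)\<^sup>2" by (simp add: power2_eq_square flip: exp_add)
    then have "exp s \<le> exp 1 * n" by (rule power2_le_imp_le) (use n in simp)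
    then have "s \<le> ln (exp 1 * n)" using n by (metis exp_gt_zero ln_exp ln_le_cancel_iff less_le_trans)
    then show "s \<le> ln n + 1" using n by (simp add: ln_mult)
  qed
  have \<epsilon>1: "cmod (\<epsilon> j) = 1" "cnj (\<epsilon> j) = \<epsilon> j" for j using \<epsilon>[rule_format, of j] by auto
  have "seq_comb J \<epsilon> ?v = T (flat J \<epsilon> 1 (f_alpha \<alpha> s))"
    by (subst image_flat[OF J(1)]) (auto simp: \<epsilon>1)
  then have "dual_gauge \<alpha> 0 r K (seq_comb J \<epsilon> ?v) \<le> D * (n * (1 + cmod (f_alpha \<alpha> s - f_alpha \<alpha> (ln n))))"
    using bounded[OF r, of "flat J \<epsilon> 1 (f_alpha \<alpha> s)"] flat_1_quasinorm[OF J(1), of \<epsilon>] \<epsilon>1(1)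
    by (simp add: n_def)
  also have "\<dots> \<le> D * (exp s * (1 + (1 + \<bar>\<alpha>\<bar>) * 1))"
  proof (intro mult_left_mono mult_mono add_left_mono D_nonneg)
    have "cmod (f_alpha \<alpha> s - f_alpha \<alpha> (ln n)) \<le> (1 + \<bar>\<alpha>\<bar>) * \<bar>s - ln n\<bar>"
      using n s by (intro f_alpha_lipschitz) auto
    also have "\<dots> \<le> (1 + \<bar>\<alpha>\<bar>) * 1" using ln by (intro mult_left_mono) auto
    finally show "cmod (f_alpha \<alpha> s - f_alpha \<alpha> (ln n)) \<le> (1 + \<bar>\<alpha>\<bar>) * 1" .
  qed (use n in auto)
  finally show "dual_gauge \<alpha> 0 r K (seq_comb J \<epsilon> ?v) \<le> D * (2 + \<bar>\<alpha>\<bar>) * exp s"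
    by (simp add: algebra_simps)
qed

text \<open>In coordinates, with \<open>T (0, e\<^sub>j) = (a, b)\<close>, \<open>T (e\<^sub>j, 0) = (c, d)\<close>, \<open>\<sigma> = -ln r\<close> and
  \<open>\<Delta> = f (s + \<sigma>) - f \<sigma>\<close>: since \<open>(x, f(s) x)\<close> has norm about \<open>\<parallel>x\<parallel>\<close> for \<open>x\<close> a sum of \<open>e\<^sup>2\<^sup>s\<close> unit vectors,
  \<open>d - c f(s + \<sigma>) + cnj (f s) (b - a f(s + \<sigma>))\<close> is bounded, and here \<open>d - c f \<sigma>\<close> is bounded and \<open>a\<close>
  is negligible.\<close>

lemma image_second_basis_tendsto_0:
  assumes "\<alpha> \<noteq> 0" "e > 0"
  shows "\<forall>\<^sub>F j in sequentially. \<forall>r K. dual_weight r K \<longrightarrow> dual_gauge \<alpha> 0 r K (T (basis_vec 0 1 j)) \<le> e"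
proof -
  obtain \<rho> \<kappa> :: real where \<rho>: "\<rho> \<ge> 1" and \<kappa>: "\<kappa> \<ge> 1" and
    sep: "\<And>l \<sigma>. l > 0 \<Longrightarrow> \<sigma> \<ge> 0 \<Longrightarrow>
      1 / 2 \<le> cmod (shift_quot \<alpha> \<sigma> l - shift_quot \<alpha> \<sigma> (l * \<rho>)) +
              cmod (shift_quot \<alpha> \<sigma> (l * \<kappa>) - shift_quot \<alpha> \<sigma> (l * \<kappa> * \<rho>))"
    using shift_quot_separated[OF assms(1)] by blast
  define L where "L = 1 + \<bar>\<alpha>\<bar>"
  define R where "R = 2 * (D * (2 + \<bar>\<alpha>\<bar>)) + 1"
  \<comment> \<open>Makes the final bound \<open>(1 + 8 * L) * (R + D + 1) / l\<close> at most
    \<open>e\<close>.\<close>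
  define l where "l = max 1 ((1 + 8 * L) * (R + D + 1) / e)"
  define S where "S = {l, l * \<rho>, l * \<kappa>, l * \<kappa> * \<rho>}"
  \<comment> \<open>With this bound the terms containing \<open>a\<close> add at most 1 for every
    \<open>s\<close> in \<open>S\<close>.\<close>
  define \<eta> where "\<eta> = 1 / (L * (l * \<kappa> * \<rho>)\<^sup>2)"
  have L: "L \<ge> 1" by (simp add: L_def)
  have R: "R \<ge> 1" using D_nonneg by (simp add: R_def)
  have l: "l \<ge> 1" "(1 + 8 * L) * (R + D + 1) / e \<le> l" by (simp_all add: l_def)
  have lk: "l \<le> l * \<kappa>" and r0: "\<And>x. 0 < x \<Longrightarrow> x \<le> x * \<rho>" using l \<kappa> \<rho> by simp_all
  have S: "l \<le> s" "s \<le> l * \<kappa> * \<rho>" "1 \<le> s" if "s \<in> S" for s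
  proof -
    have "l \<le> l * \<rho>" "l * \<kappa> \<le> l * \<kappa> * \<rho>" "l * \<rho> \<le> l * \<kappa> * \<rho>"
      using l lk r0[of l] r0[of "l * \<kappa>"] \<rho> by (auto intro!: mult_right_mono)
    then show *: "l \<le> s" "s \<le> l * \<kappa> * \<rho>" using that lk unfolding S_def by auto
    show "1 \<le> s" using *(1) l by simp
  qed
  have \<eta>: "\<eta> > 0"
    unfolding \<eta>_def using L l(1) \<kappa> \<rho> by (intro divide_pos_pos mult_pos_pos zero_less_power) auto
  have "\<forall>\<^sub>F j in sequentially. \<forall>s\<in>S. \<forall>r K. dual_weight r K \<longrightarrow>
      dual_gauge \<alpha> s r K (T (basis_vec 1 (f_alpha \<alpha> s) j)) \<le> R"
    unfolding R_def by (intro eventually_ball_finite ballI image_mixed_basis_bound S) (simp add: S_def)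
  then show ?thesis
    using image_second_basis_fst_small[OF \<eta>]
  proof (rule eventually_elim2, intro allI impI)
    fix j r K
    assume elim: "\<forall>s\<in>S. \<forall>r K. dual_weight r K \<longrightarrow> dual_gauge \<alpha> s r K (T (basis_vec 1 (f_alpha \<alpha> s) j)) \<le> R"
      "\<forall>r K. dual_weight r K \<longrightarrow> (\<Sum>k\<in>K. r k * cmod (fst (T (basis_vec 0 1 j)) k)) \<le> \<eta>"
      "dual_weight r K"
    note dw = elim(3)
    define a where "a = fst (T (basis_vec 0 1 j))"
    define b where "b = snd (T (basis_vec 0 1 j))"
    define c where "c = fst (T (basis_vec 1 0 j))"
    define d where "d = snd (T (basis_vec 1 0 j))"
    define \<sigma> where "\<sigma> k = - ln (r k)" for k
    define \<beta> where "\<beta> k = b k - a k * f_alpha \<alpha> (\<sigma> k)" for k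
    define G where "G s k = shift_quot \<alpha> (\<sigma> k) s" for s k
    have r: "0 \<le> r k" and \<sigma>: "0 \<le> \<sigma> k" if "k \<in> K" for k
      using dual_weightD(2,5)[OF dw that] by (auto simp: \<sigma>_def)
    have w: "(\<Sum>k\<in>K. r k * cmod (d k - c k * f_alpha \<alpha> (\<sigma> k))) \<le> D"
      using bounded[OF dw, of "basis_vec 1 0 j"] flat_1_quasinorm(2)[of "{j}" "\<lambda>_. 1" \<alpha> 0]
      by (simp add: dual_gauge_def c_def d_def \<sigma>_def)
    have a: "(\<Sum>k\<in>K. r k * cmod (a k)) \<le> \<eta>" using elim dw by (simp add: a_def)
    have key: "(\<Sum>k\<in>K. r k * cmod (\<beta> k - c k * G s k)) \<le> (R + D + 1) / l" if s: "s \<in> S" for s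
    proof -
      define m where "m k = d k + cnj (f_alpha \<alpha> s) * b k -
          (c k + cnj (f_alpha \<alpha> s) * a k) * f_alpha \<alpha> (s + \<sigma> k)" for k
      have s1: "1 \<le> s" using S[OF s] by simp
      have m: "(\<Sum>k\<in>K. r k * cmod (m k)) \<le> R"
      proof -
        have "dual_gauge \<alpha> s r K (T (basis_vec 1 (f_alpha \<alpha> s) j)) \<le> R" using elim(1) s dw by blast
        then show ?thesis unfolding image_mixed_basis[where b = "f_alpha \<alpha> s"]
          by (simp add: dual_gauge_def seq_add_def seq_scale_def m_def a_def b_def c_def d_def \<sigma>_def)
      qed
      have "s * (r k * cmod (\<beta> k - c k * G s k)) \<le>
          r k * cmod (m k) + r k * cmod (d k - c k * f_alpha \<alpha> (\<sigma> k)) + L * s\<^sup>2 * (r k * cmod (a k))"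
        if k: "k \<in> K" for k
      proof -
        define \<Delta> where "\<Delta> = f_alpha \<alpha> (s + \<sigma> k) - f_alpha \<alpha> (\<sigma> k)"
        have \<Delta>: "cmod \<Delta> \<le> L * s"
          using f_alpha_lipschitz[of "s + \<sigma> k" "\<sigma> k" \<alpha>] \<sigma>[OF k] s1 by (simp add: \<Delta>_def L_def)
        have fs: "f_alpha \<alpha> s \<noteq> 0" "cmod (cnj (f_alpha \<alpha> s)) = s"
          using s1 by (simp_all add: f_alpha_pos norm_mult)
        have "cnj (f_alpha \<alpha> s) * (\<beta> k - c k * G s k) = cnj (f_alpha \<alpha> s) * \<beta> k - c k * \<Delta>"
        proof -
          have "\<Delta> = cnj (f_alpha \<alpha> s) * G s k"
            using fs by (simp add: G_def shift_quot_def \<Delta>_def)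
          then show ?thesis by (simp only: right_diff_distrib mult.left_commute)
        qed
        \<comment> \<open>Subtracting \<open>d - c * f(\<sigma>)\<close> from \<open>m\<close>
          removes \<open>d\<close>; evaluating \<open>a\<close> at \<sigma> in \<beta> rather than
          at \<open>s + \<sigma>\<close> leaves the last term.\<close>
        also have "\<dots> = (m k - (d k - c k * f_alpha \<alpha> (\<sigma> k))) + cnj (f_alpha \<alpha> s) * (a k * \<Delta>)"
          by (simp add: m_def \<beta>_def \<Delta>_def algebra_simps)
        finally have "s * cmod (\<beta> k - c k * G s k) =
            cmod ((m k - (d k - c k * f_alpha \<alpha> (\<sigma> k))) + cnj (f_alpha \<alpha> s) * (a k * \<Delta>))"
          using fs(2) by (metis norm_mult)
        also have "\<dots> \<le> cmod (m k) + cmod (d k - c k * f_alpha \<alpha> (\<sigma> k)) + s * (cmod (a k) * cmod \<Delta>)"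
          using norm_triangle_ineq[of "m k - (d k - c k * f_alpha \<alpha> (\<sigma> k))" "cnj (f_alpha \<alpha> s) * (a k * \<Delta>)"]
            norm_triangle_ineq4[of "m k" "d k - c k * f_alpha \<alpha> (\<sigma> k)"] s1
          by (simp add: norm_mult)
        also have "s * (cmod (a k) * cmod \<Delta>) \<le> s * (cmod (a k) * (L * s))"
          using \<Delta> s1 by (intro mult_left_mono) auto
        finally have "r k * (s * cmod (\<beta> k - c k * G s k)) \<le> r k * (cmod (m k) +
            cmod (d k - c k * f_alpha \<alpha> (\<sigma> k)) + s * (cmod (a k) * (L * s)))"
          using r[OF k] by (intro mult_left_mono) auto
        then show ?thesis by (simp add: algebra_simps power2_eq_square)
      qed
      then have "s * (\<Sum>k\<in>K. r k * cmod (\<beta> k - c k * G s k)) \<le>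
          (\<Sum>k\<in>K. r k * cmod (m k)) + (\<Sum>k\<in>K. r k * cmod (d k - c k * f_alpha \<alpha> (\<sigma> k))) +
          L * s\<^sup>2 * (\<Sum>k\<in>K. r k * cmod (a k))"
        unfolding sum_distrib_left sum.distrib[symmetric] by (rule sum_mono)
      also have "L * s\<^sup>2 * (\<Sum>k\<in>K. r k * cmod (a k)) \<le> L * (l * \<kappa> * \<rho>)\<^sup>2 * \<eta>"
        using S[OF s] L a r by (intro mult_mono power_mono sum_nonneg mult_nonneg_nonneg) auto
      also have "\<dots> = 1" using L l(1) \<kappa> \<rho> by (simp add: \<eta>_def)
      finally have "s * (\<Sum>k\<in>K. r k * cmod (\<beta> k - c k * G s k)) \<le> R + D + 1"
        using m w by linarith
      moreover have "l * (\<Sum>k\<in>K. r k * cmod (\<beta> k - c k * G s k)) \<le> s * (\<Sum>k\<in>K. r k * cmod (\<beta> k - c k * G s k))"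
        using S[OF s] r by (intro mult_right_mono sum_nonneg) auto
      ultimately show ?thesis using l(1) by (simp add: field_simps)
    qed
    define E where "E = (R + D + 1) / l"
    define q where "q s = (\<Sum>k\<in>K. r k * cmod (\<beta> k - c k * G s k))" for s
    have "r k * cmod (\<beta> k) \<le> r k * cmod (\<beta> k - c k * G l k) + 2 * L * (r k * cmod (\<beta> k - c k * G l k) +
        r k * cmod (\<beta> k - c k * G (l * \<rho>) k) + r k * cmod (\<beta> k - c k * G (l * \<kappa>) k) +
        r k * cmod (\<beta> k - c k * G (l * \<kappa> * \<rho>) k))" if k: "k \<in> K" for k
    proof -
      define N where "N s = cmod (\<beta> k - c k * G s k)" for s
      \<comment> \<open>Taking the difference at two values of \<open>s\<close> eliminates \<beta>.
        By the separation, \<open>c\<close> is then at most twice the sum of the four errors, and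
        multiplying by \<open>cmod (G l k) \<le> L\<close> gives the factor
        \<open>1 + 8 * L\<close>.\<close>
      have diff: "cmod (c k) * cmod (G s k - G t k) \<le> N s + N t" for s t
        using norm_triangle_ineq4[of "\<beta> k - c k * G t k" "\<beta> k - c k * G s k"]
        by (simp add: N_def norm_mult[symmetric] right_diff_distrib)
      have "cmod (c k) * (1 / 2) \<le> cmod (c k) * (cmod (G l k - G (l * \<rho>) k) +
          cmod (G (l * \<kappa>) k - G (l * \<kappa> * \<rho>) k))"
        unfolding G_def using l(1) \<sigma>[OF k] by (intro mult_left_mono sep) auto
      then have c: "cmod (c k) \<le> 2 * (N l + N (l * \<rho>) + N (l * \<kappa>) + N (l * \<kappa> * \<rho>))"
        using diff[of l "l * \<rho>"] diff[of "l * \<kappa>" "l * \<kappa> * \<rho>"] by (simp add: distrib_left)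
      have "cmod (G l k) \<le> L"
        unfolding G_def L_def using l(1) \<sigma>[OF k] by (intro norm_shift_quot_le) auto
      have "cmod (\<beta> k) \<le> N l + cmod (c k * G l k)"
        using norm_triangle_ineq[of "\<beta> k - c k * G l k" "c k * G l k"] by (simp add: N_def)
      also have "cmod (c k * G l k) \<le> 2 * (N l + N (l * \<rho>) + N (l * \<kappa>) + N (l * \<kappa> * \<rho>)) * L"
        unfolding norm_mult using c \<open>cmod (G l k) \<le> L\<close> by (intro mult_mono) (auto simp: N_def)
      finally have "r k * cmod (\<beta> k) \<le>
          r k * (N l + 2 * (N l + N (l * \<rho>) + N (l * \<kappa>) + N (l * \<kappa> * \<rho>)) * L)"
        using r[OF k] by (intro mult_left_mono) auto
      then show ?thesis by (simp add: N_def algebra_simps)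
    qed
    then have "(\<Sum>k\<in>K. r k * cmod (\<beta> k)) \<le> q l + 2 * L * (q l + q (l * \<rho>) + q (l * \<kappa>) + q (l * \<kappa> * \<rho>))"
      unfolding q_def sum_distrib_left sum.distrib[symmetric] by (rule sum_mono)
    also have "\<dots> \<le> E + 2 * L * (E + E + E + E)"
      using L unfolding q_def E_def by (intro add_mono mult_left_mono key) (auto simp: S_def)
    also have "\<dots> = (1 + 8 * L) * (R + D + 1) / l"
      by (simp add: E_def algebra_simps add_divide_distrib)
    also have "\<dots> \<le> e"
      using l assms(2) by (simp add: field_simps)
    finally show "dual_gauge \<alpha> 0 r K (T (basis_vec 0 1 j)) \<le> e"
      by (simp add: dual_gauge_def \<beta>_def \<sigma>_def a_def b_def)
  qed
qed

end

section \<open>Factorizations\<close>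

lemma cbs_transport_simps [simp]:
  "cbs_carrier (cbs_transport g W) = g ` cbs_carrier W"
  "cbs_add (cbs_transport g W) x y = g (cbs_add W (inv g x) (inv g y))"
  "cbs_scale (cbs_transport g W) a x = g (cbs_scale W a (inv g x))"
  "cbs_norm (cbs_transport g W) x = cbs_norm W (inv g x)"
  by (simp_all add: cbs_transport_def)

lemma cbs_conj_simps [simp]:
  "cbs_carrier (cbs_conj W) = cbs_carrier W"
  "cbs_add (cbs_conj W) = cbs_add W"
  "cbs_scale (cbs_conj W) a x = cbs_scale W (cnj a) x"
  "cbs_norm (cbs_conj W) = cbs_norm W"
  by (simp_all add: cbs_conj_def)

lemma inj_seq_pair:
  fixes g :: "(nat \<Rightarrow> complex) \<Rightarrow> 'a"
  assumes "inj g"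
  shows "\<exists>g' :: (nat \<Rightarrow> complex) \<times> (nat \<Rightarrow> complex) \<Rightarrow> 'a. inj g'"
proof -
  let ?p = "\<lambda>(x, y) n :: nat. if even n then x (n div 2) else y (n div 2) :: complex"
  have "inj ?p"
  proof (rule injI)
    fix v w assume eq: "?p v = ?p w"
    have "fst v n = fst w n \<and> snd v n = snd w n" for n
      using fun_cong[OF eq, of "2 * n"] fun_cong[OF eq, of "2 * n + 1"] by (simp add: case_prod_unfold)
    then show "v = w" by (simp add: prod_eq_iff fun_eq_iff)
  qed
  then have "inj (g \<circ> ?p)" using assms by (intro inj_compose)
  then show ?thesis by blast
qed

lemma transport_factors_over_Z:
  fixes g :: "(nat \<Rightarrow> complex) \<times> (nat \<Rightarrow> complex) \<Rightarrow> 'a" and h :: "(nat \<Rightarrow> complex) \<times> (nat \<Rightarrow> complex) \<Rightarrow> 'b"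
  assumes "inj g" "inj h"
  shows "factors_over_Z \<alpha> (cbs_transport g (Z_normed \<alpha>)) (cbs_transport h (Z_normed \<alpha>)) (h \<circ> inv g)"
  unfolding factors_over_Z_def
proof (intro exI conjI ballI)
  have inv [simp]: "inv g (g v) = v" "inv h (h v) = v" for v using assms by simp_all
  show "cbs_bounded_linear (cbs_transport g (Z_normed \<alpha>)) (Z_alpha \<alpha>) (inv g)"
    unfolding cbs_bounded_linear_def
    using quasinorm_le_Z_norm by (auto intro!: exI[of _ "17 * (1 + \<bar>\<alpha>\<bar>)"])
  show "cbs_bounded_linear (Z_alpha \<alpha>) (cbs_transport h (Z_normed \<alpha>)) h"
    unfolding cbs_bounded_linear_def
    using Z_norm_le_quasinorm by (auto intro!: exI[of _ "2 * (1 + \<bar>\<alpha>\<bar>)"])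
qed simp

lemma conj_transport_not_factors_over_Z:
  fixes g :: "(nat \<Rightarrow> complex) \<times> (nat \<Rightarrow> complex) \<Rightarrow> 'a" and h :: "(nat \<Rightarrow> complex) \<times> (nat \<Rightarrow> complex) \<Rightarrow> 'b"
  assumes \<alpha>: "\<alpha> \<noteq> 0" and inj: "inj g" "inj h"
  shows "\<not> factors_over_Z \<alpha> (cbs_conj (cbs_transport g (Z_normed \<alpha>)))
    (cbs_conj (cbs_transport h (Z_normed \<alpha>))) (h \<circ> inv g)"
proof
  assume "factors_over_Z \<alpha> (cbs_conj (cbs_transport g (Z_normed \<alpha>)))
    (cbs_conj (cbs_transport h (Z_normed \<alpha>))) (h \<circ> inv g)"
  then obtain A B where
    A: "cbs_bounded_linear (cbs_conj (cbs_transport g (Z_normed \<alpha>))) (Z_alpha \<alpha>) A" and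
    B: "cbs_bounded_linear (Z_alpha \<alpha>) (cbs_conj (cbs_transport h (Z_normed \<alpha>))) B" and
    BA: "\<And>v. v \<in> Z_carrier \<alpha> \<Longrightarrow> h (inv g (g v)) = B (A (g v))"
    unfolding factors_over_Z_def by auto
  have inv [simp]: "inv g (g v) = v" "inv h (h v) = v" for v using inj by simp_all
  define L where "L = 1 + \<bar>\<alpha>\<bar>"
  have L: "L > 0" by (simp add: L_def)
  have "\<exists>C. \<forall>v\<in>Z_carrier \<alpha>. Z_quasinorm \<alpha> (A (g v)) \<le> C * Z_norm \<alpha> v"
    using A unfolding cbs_bounded_linear_def by simp
  then obtain C1 where C1: "\<And>v. v \<in> Z_carrier \<alpha> \<Longrightarrow> Z_quasinorm \<alpha> (A (g v)) \<le> C1 * Z_norm \<alpha> v" by blast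
  have "\<exists>C. \<forall>v\<in>Z_carrier \<alpha>. Z_norm \<alpha> (inv h (B v)) \<le> C * Z_quasinorm \<alpha> v"
    using B unfolding cbs_bounded_linear_def by simp
  then obtain C2 where C2: "\<And>v. v \<in> Z_carrier \<alpha> \<Longrightarrow> Z_norm \<alpha> (inv h (B v)) \<le> C2 * Z_quasinorm \<alpha> v" by blast
  have Ac: "A (g v) \<in> Z_carrier \<alpha>" if "v \<in> Z_carrier \<alpha>" for v
    using A that unfolding cbs_bounded_linear_def by simp
  \<comment> \<open>The factors come from bounding gauges by the quasi-norm, from \<open>A\<close>,
    and from bounding \<open>Z_norm\<close> by the quasi-norm.\<close>
  interpret bounded_antilinear_on_Z \<alpha> "2 * L * (\<bar>C1\<bar> * (2 * L))" "\<lambda>v. A (g v)"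
  proof
    fix v w assume "v \<in> Z_carrier \<alpha>" "w \<in> Z_carrier \<alpha>"
    then show "A (g (seq_add v w)) = seq_add (A (g v)) (A (g w))"
      using A unfolding cbs_bounded_linear_def by simp
  next
    fix c v assume v: "v \<in> Z_carrier \<alpha>"
    have "\<forall>a. \<forall>v\<in>Z_carrier \<alpha>. A (g (seq_scale (cnj a) v)) = seq_scale a (A (g v))"
      using A unfolding cbs_bounded_linear_def by simp
    then have "A (g (seq_scale (cnj (cnj c)) v)) = seq_scale (cnj c) (A (g v))"
      using v by blast
    then show "A (g (seq_scale c v)) = seq_scale (cnj c) (A (g v))" by simp
  next
    fix r K v assume r: "dual_weight r K" and v: "v \<in> Z_carrier \<alpha>"
    have "dual_gauge \<alpha> 0 r K (A (g v)) \<le> 2 * L * Z_quasinorm \<alpha> (A (g v))"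
      unfolding L_def by (intro gauge_le_quasinorm Ac v r)
    also have "\<dots> \<le> 2 * L * (\<bar>C1\<bar> * Z_norm \<alpha> v)"
    proof (intro mult_left_mono)
      have "C1 * Z_norm \<alpha> v \<le> \<bar>C1\<bar> * Z_norm \<alpha> v" by (intro mult_right_mono Z_norm_nonneg v) auto
      then show "Z_quasinorm \<alpha> (A (g v)) \<le> \<bar>C1\<bar> * Z_norm \<alpha> v" using C1[OF v] by linarith
    qed (use L in simp)
    also have "\<dots> \<le> 2 * L * (\<bar>C1\<bar> * (2 * L * Z_quasinorm \<alpha> v))"
      using L Z_norm_le_quasinorm[OF v] by (intro mult_left_mono) (auto simp: L_def)
    finally show "dual_gauge \<alpha> 0 r K (A (g v)) \<le> 2 * L * (\<bar>C1\<bar> * (2 * L)) * Z_quasinorm \<alpha> v"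
      by (simp add: mult.assoc)
  qed
  \<comment> \<open>Forces the final bound to be 1/2; the added 1 keeps the denominator
    positive.\<close>
  define e where "e = 1 / (2 * (\<bar>C2\<bar> + 1) * (17 * L))"
  have e: "e > 0" using L by (simp add: e_def)
  obtain j where j: "\<forall>r K. dual_weight r K \<longrightarrow> dual_gauge \<alpha> 0 r K (A (g (basis_vec 0 1 j))) \<le> e"
    using image_second_basis_tendsto_0[OF \<alpha> e] by (auto simp: eventually_sequentially)
  define v where "v = basis_vec 0 1 j"
  have v: "v \<in> Z_carrier \<alpha>" by (simp add: v_def)
  \<comment> \<open>The unit weight at \<open>j\<close> bounds the norm of \<open>(0, e_j)\<close>
    below by 1, uniformly in \<open>j\<close>.\<close>
  have "1 = dual_gauge \<alpha> 0 (\<lambda>_. 1) {j} v"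
    by (simp add: dual_gauge_def v_def flat_def)
  also have "\<dots> \<le> Z_norm \<alpha> v"
    by (intro gauge_le_Z_norm v dual_weight_single) auto
  also have "\<dots> \<le> C2 * Z_quasinorm \<alpha> (A (g v))"
    using C2[OF Ac[OF v]] BA[OF v] by (metis inv)
  also have "\<dots> \<le> (\<bar>C2\<bar> + 1) * Z_quasinorm \<alpha> (A (g v))"
    by (intro mult_right_mono Z_quasinorm_nonneg Ac v) auto
  also have "\<dots> \<le> (\<bar>C2\<bar> + 1) * (17 * L * e)"
    unfolding L_def using j by (intro mult_left_mono quasinorm_by_gauges(2)) (auto simp: v_def)
  also have "\<dots> = 1 / 2" using L by (simp add: e_def)
  finally show False by simp
qed

theorem mainTheorem2:
  fixes \<alpha> :: real
  assumes "\<alpha> \<noteq> 0"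
    and "\<exists>g :: (nat \<Rightarrow> complex) \<Rightarrow> 'a. inj g"
    and "\<exists>h :: (nat \<Rightarrow> complex) \<Rightarrow> 'b. inj h"
  shows "\<exists>(X :: 'a cbs) (Y :: 'b cbs) (T :: 'a \<Rightarrow> 'b).
           complex_banach X \<and> complex_banach Y \<and> cbs_bounded_linear X Y T \<and>
           (factors_over_Z \<alpha> X Y T \<noteq> factors_over_Z \<alpha> (cbs_conj X) (cbs_conj Y) T)"
proof -
  obtain g :: "(nat \<Rightarrow> complex) \<times> (nat \<Rightarrow> complex) \<Rightarrow> 'a" where g: "inj g"
    using assms(2) inj_seq_pair by blast
  obtain h :: "(nat \<Rightarrow> complex) \<times> (nat \<Rightarrow> complex) \<Rightarrow> 'b" where h: "inj h"
    using assms(3) inj_seq_pair by blast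
  have "cbs_bounded_linear (cbs_transport g (Z_normed \<alpha>)) (cbs_transport h (Z_normed \<alpha>)) (h \<circ> inv g)"
    unfolding cbs_bounded_linear_def using g h by (auto intro!: exI[of _ 1])
  then show ?thesis
    using transport_factors_over_Z[OF g h] conj_transport_not_factors_over_Z[OF assms(1) g h]
      complex_banach_transport[OF g complex_banach_Z_normed] complex_banach_transport[OF h complex_banach_Z_normed]
    by blast
qed

end
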